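(* For every integer $n\ge 7$ that is not of the form $n=(2k+1)^2-3$ with $k\in\mathbb{N}$, one has $$g(n)=\frac{n(n+1)}{2}.$$
   Context: $\mathbb{S}^{n-1}$ denotes the unit sphere in $\mathbb{R}^n$. A two-distance set in $\mathbb{S}^{n-1}$ is a finite subset of $\mathbb{S}^{n-1}$ whose pairs of distinct points realize exactly two distinct distances (equivalently, exactly two distinct scalar products). $g(n)$ denotes the maximum cardinality of a two-distance set in $\mathbb{S}^{n-1}$. *)

theory Defs
  imports "HOL-Analysis.Analysis"
begin

definition distances :: "'a::metric_space set \<Rightarrow> real set" where
  "distances S = {dist x y | x y. x \<in> S \<and> y \<in> S \<and> x \<noteq> y}"

definition two_distance_set :: "'a::metric_space set \<Rightarrow> bool" where
  "two_distance_set S \<longleftrightarrow> finite S \<and> card (distances S) = 2"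

(* The argument only carries the ambient space real ^ 'n, so that n = CARD('n).
   Max is unspecified on infinite sets: a value computed for g therefore includes
   the claim that the cardinalities are bounded. *)
definition g :: "'n::finite itself \<Rightarrow> nat" where
  "g _ = Max {card S | S :: (real ^ 'n) set. S \<subseteq> sphere 0 1 \<and> two_distance_set S}"

end

(* For a two-distance set X with inner products b < a and a + b >= 0, a vector c on X that annihilates all
   quadratic moments satisfies (1 - a) (1 - b) |c|^2 = - (a + b) |sum c x|^2, so it vanishes and
   |X| <= n (n + 1) / 2. If a + b < 0 and |X| > 2 n + 2, then (1 - b) / (a - b) is an integer k, and the
   points lift to equiangular unit vectors in dimension n + 1 with inner products +-1 / q, q = 2 k - 1.
   For q^2 >= n + 4 the relative bound is enough; q^2 = n + 3 is excluded. For q^2 <= n + 2 one projects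
   along one of the vectors, which yields unit vectors with inner products 1 / (q + 1) and -1 / (q - 1).
   A linear programming bound with a cubic polynomial settles n <= q^2 + 2, and a bound for the trace of a
   matrix with few positive eigenvalues settles larger n. The pairwise sums of the vertices of a regular
   simplex attain the bound. *)
theory Submission imports Defs begin

section \<open>Underdetermined homogeneous linear systems\<close>

text \<open>Fraction-free elimination stays inside an integral domain, so the solution is available
  over \<open>int\<close> for the eigenvector argument as well as over the reals for the moment
  argument.\<close>

lemma homogeneous_system_nontrivial_solution:
  fixes B :: "'s \<Rightarrow> 't \<Rightarrow> 'f::idom"
  assumes "finite S" "finite T" "card S < card T"
  shows "\<exists>v. (\<exists>t\<in>T. v t \<noteq> 0) \<and> (\<forall>s\<in>S. (\<Sum>t\<in>T. B s t * v t) = 0)"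
  using assms
proof (induction S arbitrary: T B rule: finite_induct)
  case empty
  then obtain t where "t \<in> T" by fastforce
  then show ?case by (intro exI[of _ "\<lambda>_. 1"]) auto
next
  case (insert s S)
  show ?case
  proof (cases "\<forall>t\<in>T. B s t = 0")
    case True
    have "card S < card T" using insert by simp
    from insert.IH[OF insert.prems(1) this, of B] obtain v where
      "\<exists>t\<in>T. v t \<noteq> 0" "\<forall>s\<in>S. (\<Sum>t\<in>T. B s t * v t) = 0" by blast
    with True show ?thesis by (intro exI[of _ v]) auto
  next
    case False
    then obtain t0 where t0: "t0 \<in> T" "B s t0 \<noteq> 0" by blast
    define p where "p = B s t0"
    define T' where "T' = T - {t0}"
    have T: "finite T'" "card S < card T'" "T = insert t0 T'" "t0 \<notin> T'"
      using insert t0 by (auto simp: T'_def)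
    \<comment> \<open>Cross-multiplying with the pivot \<open>p\<close> removes the unknown
      \<open>t0\<close> from the other equations without a division; \<open>v\<close> below recovers
      \<open>t0\<close> from equation \<open>s\<close>.\<close>
    from insert.IH[OF T(1,2), of "\<lambda>r t. p * B r t - B r t0 * B s t"]
    obtain v' t1 where v': "t1 \<in> T'" "v' t1 \<noteq> 0"
      "\<And>r. r \<in> S \<Longrightarrow> (\<Sum>t\<in>T'. (p * B r t - B r t0 * B s t) * v' t) = 0"
      by blast
    define v where "v t = (if t = t0 then - (\<Sum>t\<in>T'. B s t * v' t) else p * v' t)" for t
    have sum: "(\<Sum>t\<in>T. B r t * v t) = (\<Sum>t\<in>T'. (p * B r t - B r t0 * B s t) * v' t)" for r
    proof -
      have "(\<Sum>t\<in>T'. B r t * v t) = (\<Sum>t\<in>T'. B r t * (p * v' t))"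
        using T by (intro sum.cong) (auto simp: v_def)
      then show ?thesis using T
        by (simp add: v_def sum_distrib_left sum_subtractf algebra_simps)
    qed
    have "v t1 \<noteq> 0" "t1 \<in> T" using v' T t0 by (auto simp: v_def p_def)
    moreover have "(\<Sum>t\<in>T. B r t * v t) = 0" if "r \<in> insert s S" for r
      using that v'(3) unfolding sum by (auto simp: p_def)
    ultimately show ?thesis by blast
  qed
qed

section \<open>Gegenbauer inequalities of degree 2 and 3\<close>

text \<open>The square of \<open>y i \<bullet> y j\<close> is the inner product of the rank one
  matrices of \<open>y i\<close> and \<open>y j\<close>, so both sides are the squared Frobenius
  norm of the sum of these matrices weighted by \<open>c\<close>.\<close>

lemma sum_mult_inner_power2:
  fixes y :: "'i \<Rightarrow> 'e::euclidean_space"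
  shows "(\<Sum>i\<in>I. \<Sum>j\<in>I. c i * c j * (y i \<bullet> y j)\<^sup>2) =
    (\<Sum>p\<in>Basis. \<Sum>q\<in>Basis. (\<Sum>i\<in>I. c i * (y i \<bullet> p) * (y i \<bullet> q))\<^sup>2)"
proof -
  have "(\<Sum>i\<in>I. \<Sum>j\<in>I. c i * c j * (y i \<bullet> y j)\<^sup>2) =
    (\<Sum>i\<in>I. \<Sum>j\<in>I. \<Sum>p\<in>Basis. \<Sum>q\<in>Basis. (c i * (y i \<bullet> p) * (y i \<bullet> q)) * (c j * (y j \<bullet> p) * (y j \<bullet> q)))"
    by (simp add: power2_eq_square euclidean_inner[of "y _" "y _"] sum_product sum_distrib_left algebra_simps)
  also have "\<dots> = (\<Sum>i\<in>I. \<Sum>p\<in>Basis. \<Sum>q\<in>Basis. \<Sum>j\<in>I. (c i * (y i \<bullet> p) * (y i \<bullet> q)) * (c j * (y j \<bullet> p) * (y j \<bullet> q)))"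
    by (intro sum.cong refl) (subst sum.swap, intro sum.cong refl, rule sum.swap)
  also have "\<dots> = (\<Sum>p\<in>Basis. \<Sum>q\<in>Basis. \<Sum>i\<in>I. \<Sum>j\<in>I. (c i * (y i \<bullet> p) * (y i \<bullet> q)) * (c j * (y j \<bullet> p) * (y j \<bullet> q)))"
    by (subst sum.swap, intro sum.cong refl, rule sum.swap)
  finally show ?thesis by (simp add: power2_eq_square sum_product)
qed

lemma sum_mult_inner:
  fixes y :: "'i \<Rightarrow> 'e::real_inner"
  shows "(\<Sum>i\<in>I. \<Sum>j\<in>I. c i * c j * (y i \<bullet> y j)) = (norm (\<Sum>i\<in>I. c i *\<^sub>R y i))\<^sup>2"
  unfolding power2_norm_eq_inner inner_sum_left inner_sum_right
  by (simp add: sum_distrib_left mult.assoc) (simp add: inner_commute)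

text \<open>For unit vectors the moment matrix \<open>A\<close> has the sum of the
  \<open>c i\<close> as its trace, and by Cauchy-Schwarz a squared trace is at most the dimension
  times the squared Frobenius norm.\<close>

lemma gegenbauer2_nonneg:
  fixes y :: "'i \<Rightarrow> 'e::euclidean_space"
  assumes "\<And>i. i \<in> I \<Longrightarrow> norm (y i) = 1"
  shows "(\<Sum>i\<in>I. c i)\<^sup>2 \<le> DIM('e) * (\<Sum>i\<in>I. \<Sum>j\<in>I. c i * c j * (y i \<bullet> y j)\<^sup>2)"
proof -
  define A where "A p q = (\<Sum>i\<in>I. c i * (y i \<bullet> p) * (y i \<bullet> q))" for p q :: 'e
  have "(\<Sum>i\<in>I. c i) = (\<Sum>i\<in>I. c i * (y i \<bullet> y i))"
    using assms by (intro sum.cong) (auto simp: norm_eq_1)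
  also have "\<dots> = (\<Sum>i\<in>I. \<Sum>p\<in>Basis. c i * (y i \<bullet> p) * (y i \<bullet> p))"
    by (simp add: euclidean_inner[of "y _" "y _"] sum_distrib_left algebra_simps)
  also have "\<dots> = (\<Sum>p\<in>Basis. A p p)"
    unfolding A_def by (rule sum.swap)
  finally have "(\<Sum>i\<in>I. c i)\<^sup>2 \<le> DIM('e) * (\<Sum>p\<in>Basis. (A p p)\<^sup>2)"
    using sum_squared_le_sum_of_squares[of "\<lambda>p. A p p" "Basis :: 'e set"]
    by (simp add: mult.commute)
  also have "(\<Sum>p\<in>Basis. (A p p)\<^sup>2) \<le> (\<Sum>p\<in>Basis. \<Sum>q\<in>Basis. (A p q)\<^sup>2)"
    by (intro sum_mono member_le_sum) auto
  also have "\<dots> = (\<Sum>i\<in>I. \<Sum>j\<in>I. c i * c j * (y i \<bullet> y j)\<^sup>2)"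
    unfolding A_def by (rule sum_mult_inner_power2[symmetric])
  finally show ?thesis by (simp add: mult_left_mono)
qed

text \<open>\<open>T\<close> is the third moment tensor, whose squared norm is the sum of the cubes,
  and \<open>e * Z\<close> is its trace part; the traceless remainder has nonnegative squared
  norm.\<close>

lemma gegenbauer3_nonneg:
  fixes y :: "'i \<Rightarrow> 'e::euclidean_space"
  assumes "\<And>i. i \<in> I \<Longrightarrow> norm (y i) = 1"
  shows "3 * (norm (\<Sum>i\<in>I. y i))\<^sup>2 \<le> (DIM('e) + 2) * (\<Sum>i\<in>I. \<Sum>j\<in>I. (y i \<bullet> y j) ^ 3)"
proof -
  let ?B = "Basis :: 'e set"
  define T where "T p q r = (\<Sum>i\<in>I. (y i \<bullet> p) * (y i \<bullet> q) * (y i \<bullet> r))" for p q r :: 'e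
  define z where "z = (\<Sum>i\<in>I. y i)"
  define d :: "'e \<Rightarrow> 'e \<Rightarrow> real" where "d p q = (if p = q then 1 else 0)" for p q
  \<comment> \<open>Since \<open><T, Z> = 3 |z|^2\<close> and
    \<open>|Z|^2 = 3 (D + 2) |z|^2\<close>, this factor minimizes the norm of
    \<open>T - e Z\<close>.\<close>
  define e where "e = 1 / (real DIM('e) + 2)"
  have T2: "(\<Sum>p\<in>?B. \<Sum>q\<in>?B. \<Sum>r\<in>?B. (T p q r)\<^sup>2) = (\<Sum>i\<in>I. \<Sum>j\<in>I. (y i \<bullet> y j) ^ 3)"
  proof -
    have "(\<Sum>i\<in>I. \<Sum>j\<in>I. (y i \<bullet> y j) ^ 3) = (\<Sum>i\<in>I. \<Sum>j\<in>I. (\<Sum>p\<in>?B. (y i \<bullet> p) * (y j \<bullet> p)) * (y i \<bullet> y j)\<^sup>2)"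
      by (simp add: power3_eq_cube power2_eq_square mult.assoc flip: euclidean_inner)
    also have "\<dots> = (\<Sum>i\<in>I. \<Sum>j\<in>I. \<Sum>p\<in>?B. (y i \<bullet> p) * (y j \<bullet> p) * (y i \<bullet> y j)\<^sup>2)"
      by (simp add: sum_distrib_right)
    also have "\<dots> = (\<Sum>i\<in>I. \<Sum>p\<in>?B. \<Sum>j\<in>I. (y i \<bullet> p) * (y j \<bullet> p) * (y i \<bullet> y j)\<^sup>2)"
      by (intro sum.cong refl sum.swap)
    also have "\<dots> = (\<Sum>p\<in>?B. \<Sum>i\<in>I. \<Sum>j\<in>I. (y i \<bullet> p) * (y j \<bullet> p) * (y i \<bullet> y j)\<^sup>2)"
      by (rule sum.swap)
    also have "\<dots> = (\<Sum>p\<in>?B. \<Sum>q\<in>?B. \<Sum>r\<in>?B. (T p q r)\<^sup>2)"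
      unfolding T_def by (intro sum.cong refl sum_mult_inner_power2)
    finally show ?thesis by simp
  qed
  have Ttr: "(\<Sum>q\<in>?B. T p q q) = z \<bullet> p" for p
  proof -
    have "(\<Sum>q\<in>?B. T p q q) = (\<Sum>i\<in>I. \<Sum>q\<in>?B. (y i \<bullet> p) * ((y i \<bullet> q) * (y i \<bullet> q)))"
      unfolding T_def by (subst sum.swap) (simp add: algebra_simps)
    also have "\<dots> = (\<Sum>i\<in>I. (y i \<bullet> p) * (y i \<bullet> y i))"
      by (simp add: euclidean_inner[of "y _" "y _"] sum_distrib_left)
    also have "\<dots> = z \<bullet> p"
      using assms by (auto simp: z_def inner_sum_left norm_eq_1)
    finally show ?thesis .
  qed
  have Tsym: "T p q r = T r p q" "T p q r = T q r p" for p q r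
    by (auto simp: T_def mult_ac)
  have zz: "(\<Sum>p\<in>?B. (z \<bullet> p)\<^sup>2) = (norm z)\<^sup>2"
    unfolding power2_norm_eq_inner euclidean_inner[of z z] by (simp add: power2_eq_square)
  have TZ1: "(\<Sum>p\<in>?B. \<Sum>q\<in>?B. \<Sum>r\<in>?B. T p q r * ((z \<bullet> p) * d q r)) = (norm z)\<^sup>2"
  proof -
    have "(\<Sum>p\<in>?B. \<Sum>q\<in>?B. \<Sum>r\<in>?B. T p q r * ((z \<bullet> p) * d q r)) = (\<Sum>p\<in>?B. (z \<bullet> p) * (\<Sum>q\<in>?B. T p q q))"
      by (simp add: d_def if_distrib sum_distrib_left mult_ac cong: if_cong)
    then show ?thesis by (simp add: Ttr flip: zz power2_eq_square)
  qed
  have TZ2: "(\<Sum>p\<in>?B. \<Sum>q\<in>?B. \<Sum>r\<in>?B. T p q r * ((z \<bullet> q) * d p r)) = (norm z)\<^sup>2"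
    unfolding TZ1[symmetric] by (subst sum.swap) (simp add: Tsym(2) mult_ac T_def)
  have TZ3: "(\<Sum>p\<in>?B. \<Sum>q\<in>?B. \<Sum>r\<in>?B. T p q r * ((z \<bullet> r) * d p q)) = (norm z)\<^sup>2"
  proof -
    have "(\<Sum>p\<in>?B. \<Sum>q\<in>?B. \<Sum>r\<in>?B. T p q r * ((z \<bullet> r) * d p q)) = 
      (\<Sum>p\<in>?B. \<Sum>r\<in>?B. \<Sum>q\<in>?B. T p q r * ((z \<bullet> r) * d p q))"
      by (intro sum.cong refl sum.swap)
    also have "\<dots> = (\<Sum>p\<in>?B. \<Sum>q\<in>?B. \<Sum>r\<in>?B. T p q r * ((z \<bullet> q) * d p r))"
      by (simp add: T_def mult_ac)
    finally show ?thesis using TZ2 by simp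
  qed
  have dd: "d p q * d p q = d p q" "d p q = d q p" for p q by (auto simp: d_def)
  define Z where "Z p q r = (z \<bullet> p) * d q r + (z \<bullet> q) * d p r + (z \<bullet> r) * d p q" for p q r
  have TZ: "(\<Sum>p\<in>?B. \<Sum>q\<in>?B. \<Sum>r\<in>?B. T p q r * Z p q r) = 3 * (norm z)\<^sup>2"
    using TZ1 TZ2 TZ3 by (simp add: Z_def distrib_left sum.distrib)
  have ZZ: "(\<Sum>p\<in>?B. \<Sum>q\<in>?B. \<Sum>r\<in>?B. (Z p q r)\<^sup>2) = 3 * (DIM('e) + 2) * (norm z)\<^sup>2"
  proof -
    have eq: "(Z p q r)\<^sup>2 = (z \<bullet> p)\<^sup>2 * d q r + (z \<bullet> q)\<^sup>2 * d p r + (z \<bullet> r)\<^sup>2 * d p q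
       + 2 * ((z \<bullet> p) * (z \<bullet> q) * d q r * d p r) + 2 * ((z \<bullet> p) * (z \<bullet> r) * d q r * d p q)
       + 2 * ((z \<bullet> q) * (z \<bullet> r) * d p r * d p q)" for p q r
      by (simp add: Z_def power2_eq_square algebra_simps d_def)
    have sum_if: "(\<Sum>r\<in>?B. if P then f r else 0) = (if P then sum f ?B else 0)" for P and f :: "'e \<Rightarrow> real"
      by simp
    show ?thesis unfolding eq sum.distrib
      by (simp add: d_def mult_delta_right mult_delta_left sum_if zz
         flip: power2_eq_square sum_distrib_left) (simp add: algebra_simps)
  qed
  have "0 \<le> (\<Sum>p\<in>?B. \<Sum>q\<in>?B. \<Sum>r\<in>?B. (T p q r - e * Z p q r)\<^sup>2)"
    by (intro sum_nonneg) auto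
  also have "\<dots> = (\<Sum>p\<in>?B. \<Sum>q\<in>?B. \<Sum>r\<in>?B. (T p q r)\<^sup>2) - 2 * e * (\<Sum>p\<in>?B. \<Sum>q\<in>?B. \<Sum>r\<in>?B. T p q r * Z p q r)
     + e\<^sup>2 * (\<Sum>p\<in>?B. \<Sum>q\<in>?B. \<Sum>r\<in>?B. (Z p q r)\<^sup>2)"
    by (simp add: power2_diff power_mult_distrib sum.distrib sum_subtractf sum_distrib_left mult_ac)
  also have "\<dots> = (\<Sum>i\<in>I. \<Sum>j\<in>I. (y i \<bullet> y j) ^ 3) - 3 * e * (norm z)\<^sup>2"
  proof -
    have "e * (DIM('e) + 2) = 1" by (simp add: e_def)
    then have "e\<^sup>2 * (3 * (DIM('e) + 2) * (norm z)\<^sup>2) = 3 * e * (norm z)\<^sup>2"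
      unfolding of_nat_mult of_nat_numeral by algebra
    then show ?thesis unfolding TZ ZZ T2 by simp
  qed
  finally show ?thesis by (simp add: e_def z_def field_simps)
qed

section \<open>Gram-Schmidt and Bessel for functions on a finite set\<close>

text \<open>Gram-Schmidt, with orthogonality and expansions measured on \<open>I\<close> only. For
  the coordinate functions of a family of vectors it yields an orthonormal family, no larger than
  the dimension, whose span contains them.\<close>

lemma orthonormal_functions_exist:
  fixes g :: "'j \<Rightarrow> 'i \<Rightarrow> real"
  assumes "finite J" "finite I"
  shows "\<exists>V::('i \<Rightarrow> real) set. finite V \<and> card V \<le> card J \<and>
    (\<forall>v\<in>V. \<forall>w\<in>V. (\<Sum>i\<in>I. v i * w i) = (if v = w then 1 else 0)) \<and>
    (\<forall>j\<in>J. \<forall>i\<in>I. g j i = (\<Sum>v\<in>V. (\<Sum>i\<in>I. g j i * v i) * v i))"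
  using assms(1)
proof (induction J rule: finite_induct)
  case empty
  show ?case by (rule exI[of _ "{}"]) auto
next
  case (insert k J)
  then obtain V where V: "finite V" "card V \<le> card J"
    "\<And>v w. v \<in> V \<Longrightarrow> w \<in> V \<Longrightarrow> (\<Sum>i\<in>I. v i * w i) = (if v = w then 1 else 0)"
    "\<And>j i. j \<in> J \<Longrightarrow> i \<in> I \<Longrightarrow> g j i = (\<Sum>v\<in>V. (\<Sum>i\<in>I. g j i * v i) * v i)"
    by blast
  define r where "r i = g k i - (\<Sum>v\<in>V. (\<Sum>i\<in>I. g k i * v i) * v i)" for i
  have rV: "(\<Sum>i\<in>I. r i * w i) = 0" if "w \<in> V" for w
  proof -
    have "(\<Sum>i\<in>I. (\<Sum>v\<in>V. (\<Sum>i\<in>I. g k i * v i) * v i) * w i)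
       = (\<Sum>i\<in>I. \<Sum>v\<in>V. (\<Sum>i\<in>I. g k i * v i) * (v i * w i))"
      by (simp add: sum_distrib_right mult.assoc)
    also have "\<dots> = (\<Sum>v\<in>V. (\<Sum>i\<in>I. g k i * v i) * (\<Sum>i\<in>I. v i * w i))"
      by (subst sum.swap) (simp add: sum_distrib_left)
    also have "\<dots> = (\<Sum>i\<in>I. g k i * w i)"
      using that V(1) by (simp add: V(3) if_distrib cong: if_cong)
    finally show ?thesis by (simp add: r_def left_diff_distrib sum_subtractf)
  qed
  show ?case
  proof (cases "\<forall>i\<in>I. r i = 0")
    case True
    then have "g k i = (\<Sum>v\<in>V. (\<Sum>i\<in>I. g k i * v i) * v i)" if "i \<in> I" for i
      using that by (simp add: r_def)
    then show ?thesis using V insert.hyps by (intro exI[of _ V]) auto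
  next
    case False
    define s where "s = (\<Sum>i\<in>I. r i * r i)"
    have s: "s > 0" unfolding s_def
      using False assms(2) by (meson not_real_square_gt_zero sum_pos2 zero_le_square)
    define u where "u i = r i / sqrt s" for i
    have uV: "(\<Sum>i\<in>I. u i * w i) = 0" "(\<Sum>i\<in>I. w i * u i) = 0" if "w \<in> V" for w
      using rV[OF that] by (simp_all add: u_def mult_ac flip: sum_divide_distrib)
    have uu: "(\<Sum>i\<in>I. u i * u i) = 1"
      using s by (simp add: u_def flip: sum_divide_distrib s_def)
    have "u \<notin> V" using uu uV by force
    have rg: "(\<Sum>i\<in>I. g k i * r i) = s"
    proof -
      have "(\<Sum>i\<in>I. (\<Sum>v\<in>V. (\<Sum>i\<in>I. g k i * v i) * v i) * r i)
       = (\<Sum>i\<in>I. \<Sum>v\<in>V. (\<Sum>i\<in>I. g k i * v i) * (v i * r i))"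
        by (simp add: sum_distrib_right mult.assoc)
      also have "\<dots> = (\<Sum>v\<in>V. (\<Sum>i\<in>I. g k i * v i) * (\<Sum>i\<in>I. r i * v i))"
        by (subst sum.swap) (simp add: sum_distrib_left mult.commute[of "r _"])
      also have "\<dots> = 0" by (simp add: rV)
      moreover have "(\<Sum>i\<in>I. g k i * r i) = s + (\<Sum>i\<in>I. (\<Sum>v\<in>V. (\<Sum>i\<in>I. g k i * v i) * v i) * r i)"
        unfolding s_def sum.distrib[symmetric] by (intro sum.cong) (auto simp: r_def algebra_simps)
      ultimately show ?thesis by simp
    qed
    have gu: "(\<Sum>i\<in>I. g k i * u i) * u i = r i" for i
      using s by (simp add: u_def rg flip: sum_divide_distrib)
    \<comment> \<open>The earlier functions lie in the span of \<open>V\<close>, to which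
      \<open>u\<close> is orthogonal, so their expansions survive the insertion of
      \<open>u\<close>.\<close>
    have ju: "(\<Sum>i\<in>I. g j i * u i) = 0" if "j \<in> J" for j
    proof -
      have "(\<Sum>i\<in>I. g j i * u i) = (\<Sum>i\<in>I. (\<Sum>v\<in>V. (\<Sum>i\<in>I. g j i * v i) * v i) * u i)"
        using V(4)[OF that] by (intro sum.cong) auto
      also have "\<dots> = (\<Sum>i\<in>I. \<Sum>v\<in>V. (\<Sum>i\<in>I. g j i * v i) * (v i * u i))"
        by (simp add: sum_distrib_right mult.assoc)
      also have "\<dots> = (\<Sum>v\<in>V. (\<Sum>i\<in>I. g j i * v i) * (\<Sum>i\<in>I. u i * v i))"
        by (subst sum.swap) (simp add: sum_distrib_left mult.commute[of "u _"])
      also have "\<dots> = 0" by (simp add: uV)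
      finally show ?thesis .
    qed
    show ?thesis
    proof (intro exI[of _ "insert u V"] conjI ballI)
      show "finite (insert u V)" "card (insert u V) \<le> card (insert k J)"
        using V \<open>u \<notin> V\<close> insert.hyps by auto
      show "(\<Sum>i\<in>I. v i * w i) = (if v = w then 1 else 0)"
        if "v \<in> insert u V" "w \<in> insert u V" for v w
        using that V(3) uu uV \<open>u \<notin> V\<close> by auto
      show "g j i = (\<Sum>v\<in>insert u V. (\<Sum>i\<in>I. g j i * v i) * v i)"
        if "j \<in> insert k J" "i \<in> I" for j i
      proof (cases "j = k")
        case True
        then show ?thesis using V(1) \<open>u \<notin> V\<close> by (simp add: gu) (simp add: r_def)
      next
        case False
        with that have j: "j \<in> J" by simp
        have "(\<Sum>v\<in>insert u V. (\<Sum>i\<in>I. g j i * v i) * v i) = (\<Sum>v\<in>V. (\<Sum>i\<in>I. g j i * v i) * v i)"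
          using V(1) \<open>u \<notin> V\<close> j by (simp add: ju)
        also have "\<dots> = g j i" by (rule V(4)[OF j that(2), symmetric])
        finally show ?thesis by (rule sym)
      qed
    qed
  qed
qed

text \<open>Both parts compare \<open>h\<close> with its projection \<open>p\<close> onto the span
  of \<open>V\<close>. The inequality serves the constant function 1, the equality the coordinate
  functions.\<close>

lemma bessel_inequality_functions:
  fixes h :: "'i \<Rightarrow> real"
  assumes "finite V"
    "\<And>v w. v \<in> V \<Longrightarrow> w \<in> V \<Longrightarrow> (\<Sum>i\<in>I. v i * w i) = (if v = w then 1 else 0)"
  shows "(\<Sum>v\<in>V. (\<Sum>i\<in>I. h i * v i)\<^sup>2) \<le> (\<Sum>i\<in>I. (h i)\<^sup>2)"
    "(\<And>i. i \<in> I \<Longrightarrow> h i = (\<Sum>v\<in>V. (\<Sum>i\<in>I. h i * v i) * v i)) \<Longrightarrow>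
      (\<Sum>v\<in>V. (\<Sum>i\<in>I. h i * v i)\<^sup>2) = (\<Sum>i\<in>I. (h i)\<^sup>2)"
proof -
  define c where "c v = (\<Sum>i\<in>I. h i * v i)" for v
  define p where "p i = (\<Sum>v\<in>V. c v * v i)" for i
  have hp: "(\<Sum>i\<in>I. h i * p i) = (\<Sum>v\<in>V. (c v)\<^sup>2)"
  proof -
    have "(\<Sum>i\<in>I. h i * p i) = (\<Sum>i\<in>I. \<Sum>v\<in>V. c v * (h i * v i))"
      by (simp add: p_def sum_distrib_left mult_ac)
    also have "\<dots> = (\<Sum>v\<in>V. c v * c v)"
      by (subst sum.swap) (simp add: c_def[symmetric] flip: sum_distrib_left)
    finally show ?thesis by (simp add: power2_eq_square)
  qed
  have pp: "(\<Sum>i\<in>I. p i * p i) = (\<Sum>v\<in>V. (c v)\<^sup>2)"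
  proof -
    have "(\<Sum>i\<in>I. p i * p i) = (\<Sum>i\<in>I. \<Sum>v\<in>V. \<Sum>w\<in>V. c v * c w * (v i * w i))"
      by (simp add: p_def sum_product mult_ac)
    also have "\<dots> = (\<Sum>v\<in>V. \<Sum>w\<in>V. c v * c w * (\<Sum>i\<in>I. v i * w i))"
      unfolding sum_distrib_left by (subst sum.swap, intro sum.cong refl, rule sum.swap)
    also have "\<dots> = (\<Sum>v\<in>V. (c v)\<^sup>2)"
      using assms(1) by (simp add: assms(2) if_distrib power2_eq_square cong: if_cong)
    finally show ?thesis .
  qed
  have "0 \<le> (\<Sum>i\<in>I. (h i - p i)\<^sup>2)" by (intro sum_nonneg) auto
  also have "\<dots> = (\<Sum>i\<in>I. (h i)\<^sup>2) - 2 * (\<Sum>i\<in>I. h i * p i) + (\<Sum>i\<in>I. p i * p i)"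
    unfolding power2_eq_square sum_distrib_left sum_subtractf[symmetric] sum.distrib[symmetric]
    by (intro sum.cong) (auto simp: algebra_simps)
  finally show "(\<Sum>v\<in>V. (\<Sum>i\<in>I. h i * v i)\<^sup>2) \<le> (\<Sum>i\<in>I. (h i)\<^sup>2)"
    unfolding hp pp by (simp add: c_def)
  assume "\<And>i. i \<in> I \<Longrightarrow> h i = (\<Sum>v\<in>V. (\<Sum>i\<in>I. h i * v i) * v i)"
  then have "h i = p i" if "i \<in> I" for i using that by (simp add: p_def c_def)
  then have "(\<Sum>i\<in>I. h i * p i) = (\<Sum>i\<in>I. (h i)\<^sup>2)"
    by (intro sum.cong) (auto simp: power2_eq_square)
  then show "(\<Sum>v\<in>V. (\<Sum>i\<in>I. h i * v i)\<^sup>2) = (\<Sum>i\<in>I. (h i)\<^sup>2)"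
    unfolding hp by (simp add: c_def)
qed

section \<open>Bounds for equiangular vectors and their derived families\<close>

text \<open>Lets a polynomial relation between the inner products of distinct vectors lower the
  degree of a double sum, at the cost of a correction on the diagonal.\<close>

lemma sum_over_pairs_diag:
  fixes f h :: "'i \<Rightarrow> 'i \<Rightarrow> real"
  assumes "finite I" "\<And>i j. i \<in> I \<Longrightarrow> j \<in> I \<Longrightarrow> i \<noteq> j \<Longrightarrow> f i j = h i j"
  shows "(\<Sum>i\<in>I. \<Sum>j\<in>I. f i j) = (\<Sum>i\<in>I. \<Sum>j\<in>I. h i j) + (\<Sum>i\<in>I. f i i - h i i)"
proof -
  have "(\<Sum>j\<in>I. f i j) = (\<Sum>j\<in>I. h i j) + (f i i - h i i)" if "i \<in> I" for i
  proof -
    have "(\<Sum>j\<in>I - {i}. f i j) = (\<Sum>j\<in>I - {i}. h i j)"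
      using assms that by (intro sum.cong) auto
    then show ?thesis using assms(1) that by (simp add: sum.remove[of I i])
  qed
  then show ?thesis by (simp add: sum.distrib)
qed

text \<open>The degree 2 inequality with all weights equal to 1. In this product form it bounds the
  cardinality from above when \<open>q^2 > DIM('e)\<close>.\<close>

lemma equiangular_relative_bound:
  fixes y :: "'i \<Rightarrow> 'e::euclidean_space" and q :: real
  assumes "finite I" "I \<noteq> {}" "q > 0"
    and "\<And>i. i \<in> I \<Longrightarrow> norm (y i) = 1"
    and "\<And>i j. i \<in> I \<Longrightarrow> j \<in> I \<Longrightarrow> i \<noteq> j \<Longrightarrow> \<bar>y i \<bullet> y j\<bar> = 1 / q"
  shows "real (card I) * (q\<^sup>2 - DIM('e)) \<le> DIM('e) * (q\<^sup>2 - 1)"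
proof -
  let ?N = "real (card I)" and ?D = "real DIM('e)"
  have N: "?N > 0" using assms by (simp add: card_gt_0_iff)
  have "(y i \<bullet> y j)\<^sup>2 = 1 / q\<^sup>2" if "i \<in> I" "j \<in> I" "i \<noteq> j" for i j
    unfolding power2_abs[of "y i \<bullet> y j", symmetric] assms(5)[OF that] by (rule power_one_over)
  then have "(\<Sum>i\<in>I. \<Sum>j\<in>I. (y i \<bullet> y j)\<^sup>2) = (\<Sum>i\<in>I. \<Sum>j\<in>I. 1 / q\<^sup>2) + (\<Sum>i\<in>I. (y i \<bullet> y i)\<^sup>2 - 1 / q\<^sup>2)"
    by (intro sum_over_pairs_diag assms(1))
  also have "(\<Sum>i\<in>I. (y i \<bullet> y i)\<^sup>2 - 1 / q\<^sup>2) = (\<Sum>i\<in>I. 1 - 1 / q\<^sup>2)"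
    using assms(4) by (intro sum.cong) (auto simp: norm_eq_1)
  finally have "(\<Sum>i\<in>I. \<Sum>j\<in>I. (y i \<bullet> y j)\<^sup>2) = ?N * (?N / q\<^sup>2 + (1 - 1 / q\<^sup>2))"
    by (simp add: algebra_simps)
  moreover have "?N\<^sup>2 \<le> ?D * (\<Sum>i\<in>I. \<Sum>j\<in>I. (y i \<bullet> y j)\<^sup>2)"
    using gegenbauer2_nonneg[of I y "\<lambda>_. 1"] assms(4) by simp
  ultimately have "?N * ?N \<le> ?N * (?D * (?N / q\<^sup>2 + (1 - 1 / q\<^sup>2)))"
    by (simp add: power2_eq_square mult_ac)
  then have "?N \<le> ?D * (?N / q\<^sup>2 + (1 - 1 / q\<^sup>2))"
    using N by simp
  then have "?N * q\<^sup>2 \<le> ?D * (?N / q\<^sup>2 + (1 - 1 / q\<^sup>2)) * q\<^sup>2"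
    by (intro mult_right_mono) auto
  also have "\<dots> = ?D * (?N + (q\<^sup>2 - 1))"
    using assms(3) by (simp add: field_simps)
  finally show ?thesis by (simp add: algebra_simps)
qed

text \<open>Signs are switched until every vector has inner product \<open>1 / q\<close> with
  \<open>y i0\<close>; the components orthogonal to \<open>y i0\<close> are then rescaled to norm 1.
  They keep the type \<open>'e\<close>, so later bounds use the full \<open>DIM('e)\<close>.\<close>

lemma derived_two_distance_family:
  fixes y :: "'i \<Rightarrow> 'e::euclidean_space" and q :: real
  assumes "q > 1" "i0 \<in> I"
    and "\<And>i. i \<in> I \<Longrightarrow> norm (y i) = 1"
    and "\<And>i j. i \<in> I \<Longrightarrow> j \<in> I \<Longrightarrow> i \<noteq> j \<Longrightarrow> \<bar>y i \<bullet> y j\<bar> = 1 / q"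
  obtains v :: "'i \<Rightarrow> 'e" where "\<And>i. i \<in> I - {i0} \<Longrightarrow> norm (v i) = 1"
    and "\<And>i j. i \<in> I - {i0} \<Longrightarrow> j \<in> I - {i0} \<Longrightarrow> i \<noteq> j \<Longrightarrow>
      v i \<bullet> v j = 1 / (q + 1) \<or> v i \<bullet> v j = - 1 / (q - 1)"
proof
  define \<sigma> where "\<sigma> i = sgn (y i \<bullet> y i0)" for i
  define r where "r = sqrt (1 - 1 / q\<^sup>2)"
  have q2: "q\<^sup>2 > 1" using assms(1) by simp
  then have "1 / q\<^sup>2 < 1" by (simp add: divide_less_eq)
  then have r: "r * r = 1 - 1 / q\<^sup>2" "r > 0" by (auto simp: r_def)
  define v where "v i = (1 / r) *\<^sub>R (\<sigma> i *\<^sub>R y i - (1 / q) *\<^sub>R y i0)" for i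
  have \<sigma>: "\<sigma> i * \<sigma> i = 1" "\<sigma> i * (y i \<bullet> y i0) = 1 / q" "\<sigma> i = 1 \<or> \<sigma> i = - 1" if "i \<in> I - {i0}" for i
    using assms(1) assms(4)[of i i0] that assms(2)
    by (auto simp: \<sigma>_def sgn_real_def abs_if split: if_splits)
  have vv: "v i \<bullet> v j = (\<sigma> i * \<sigma> j * (y i \<bullet> y j) - 1 / q\<^sup>2) / (1 - 1 / q\<^sup>2)"
    if "i \<in> I - {i0}" "j \<in> I - {i0}" for i j
  proof -
    have "(\<sigma> i *\<^sub>R y i - (1 / q) *\<^sub>R y i0) \<bullet> (\<sigma> j *\<^sub>R y j - (1 / q) *\<^sub>R y i0) =
        \<sigma> i * \<sigma> j * (y i \<bullet> y j) - (1 / q) * (\<sigma> i * (y i \<bullet> y i0))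
        - (1 / q) * (\<sigma> j * (y j \<bullet> y i0)) + (1 / q) * (1 / q) * (y i0 \<bullet> y i0)"
      by (simp add: inner_commute[of "y i0" "y j"] algebra_simps)
    then have "v i \<bullet> v j = (\<sigma> i * \<sigma> j * (y i \<bullet> y j) - (1 / q) * (\<sigma> i * (y i \<bullet> y i0))
        - (1 / q) * (\<sigma> j * (y j \<bullet> y i0)) + (1 / q) * (1 / q) * (y i0 \<bullet> y i0)) / (r * r)"
      by (simp add: v_def)
    then show ?thesis
      using that assms(2,3) by (simp add: \<sigma> norm_eq_1 r power2_eq_square)
  qed
  show "norm (v i) = 1" if "i \<in> I - {i0}" for i
    using vv[OF that that] assms(3)[of i] that \<sigma>(1)[OF that] q2 by (simp add: norm_eq_1)
  show "v i \<bullet> v j = 1 / (q + 1) \<or> v i \<bullet> v j = - 1 / (q - 1)"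
    if ij: "i \<in> I - {i0}" "j \<in> I - {i0}" "i \<noteq> j" for i j
  proof -
    have "\<sigma> i * \<sigma> j * (y i \<bullet> y j) = 1 / q \<or> \<sigma> i * \<sigma> j * (y i \<bullet> y j) = - 1 / q"
      using \<sigma>(3)[OF ij(1)] \<sigma>(3)[OF ij(2)] assms(4)[of i j] ij by (auto simp: abs_if split: if_splits)
    moreover have "(1 / q - 1 / q\<^sup>2) / (1 - 1 / q\<^sup>2) = 1 / (q + 1)"
      "(- 1 / q - 1 / q\<^sup>2) / (1 - 1 / q\<^sup>2) = - 1 / (q - 1)"
      using assms(1) q2 by (simp_all add: divide_simps power2_eq_square) (simp_all add: algebra_simps)
    ultimately show ?thesis unfolding vv[OF ij(1,2)] by metis
  qed
qed

text \<open>The positive definite function evaluated here is the cubic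
  \<open>(t - \<beta>) (t - \<gamma>) (t + \<beta> + \<gamma>)\<close>, where \<open>\<beta> = 1 / (q + 1)\<close> and \<open>\<gamma> = - 1 / (q - 1)\<close>: the last factor
  is the one that removes the quadratic term.\<close>

lemma derived_family_cubic_bound:
  fixes v :: "'i \<Rightarrow> 'e::euclidean_space" and q M :: real
  defines "M \<equiv> q\<^sup>2 - 1"
  assumes "finite I" "I \<noteq> {}" "q > 1" "(DIM('e) + 2) * (M + 4) \<le> 3 * M\<^sup>2"
    and "\<And>i. i \<in> I \<Longrightarrow> norm (v i) = 1"
    and "\<And>i j. i \<in> I \<Longrightarrow> j \<in> I \<Longrightarrow> i \<noteq> j \<Longrightarrow> v i \<bullet> v j = 1 / (q + 1) \<or> v i \<bullet> v j = - 1 / (q - 1)"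
  shows "2 * real (card I) \<le> (M + 1) * (M - 2)"
proof -
  let ?N = "real (card I)" and ?D = "real DIM('e)"
  have N: "?N > 0" using assms by (simp add: card_gt_0_iff)
  have M1: "M = (q + 1) * (q - 1)" by (simp add: M_def power2_eq_square algebra_simps)
  have "M > 0" unfolding M1 using assms(4) by simp
  note M = M1 this
  \<comment> \<open>\<open>c = (\<beta> + \<gamma>)^2 - \<beta> \<gamma>\<close>, where
    \<open>\<beta> + \<gamma> = - 2 / M\<close> and \<open>\<beta> \<gamma> = - 1 / M\<close>; the
    constant \<open>2 / M^2\<close> below is
    \<open>\<beta> \<gamma> (\<beta> + \<gamma>)\<close>.\<close>
  define c where "c = 1 / M + 4 / M\<^sup>2"
  define z where "z = (\<Sum>i\<in>I. v i)"
  have cubic: "t ^ 3 = c * t - 2 / M\<^sup>2" if "t = 1 / (q + 1) \<or> t = - 1 / (q - 1)" for t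
    using that
  proof
    assume t: "t = 1 / (q + 1)"
    define s where "s = q + 1"
    have "s \<noteq> 0" "s - 2 \<noteq> 0" "M = s * (s - 2)" "t = 1 / s"
      using assms(4) t by (auto simp: s_def M)
    then show ?thesis
      by (simp add: c_def divide_simps power2_eq_square power3_eq_cube) algebra
  next
    assume t: "t = - 1 / (q - 1)"
    define s where "s = q - 1"
    have "s \<noteq> 0" "s + 2 \<noteq> 0" "M = s * (s + 2)" "t = - 1 / s"
      using assms(4) t by (auto simp: s_def M)
    then show ?thesis
      by (simp add: c_def divide_simps power2_eq_square power3_eq_cube) algebra
  qed
  have "(\<Sum>i\<in>I. \<Sum>j\<in>I. (v i \<bullet> v j) ^ 3) = (\<Sum>i\<in>I. \<Sum>j\<in>I. c * (v i \<bullet> v j) - 2 / M\<^sup>2)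
    + (\<Sum>i\<in>I. (v i \<bullet> v i) ^ 3 - (c * (v i \<bullet> v i) - 2 / M\<^sup>2))"
    using assms(7) by (intro sum_over_pairs_diag assms(2) cubic)
  also have "(\<Sum>i\<in>I. (v i \<bullet> v i) ^ 3 - (c * (v i \<bullet> v i) - 2 / M\<^sup>2)) = (\<Sum>i\<in>I. 1 - (c - 2 / M\<^sup>2))"
    using assms(6) by (intro sum.cong) (auto simp: norm_eq_1)
  also have "(\<Sum>i\<in>I. \<Sum>j\<in>I. c * (v i \<bullet> v j) - 2 / M\<^sup>2) = c * (norm z)\<^sup>2 - 2 / M\<^sup>2 * ?N\<^sup>2"
    using sum_mult_inner[of "\<lambda>_. 1" v I]
    by (simp add: sum_subtractf z_def power2_eq_square flip: sum_distrib_left)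
  finally have sum3: "(\<Sum>i\<in>I. \<Sum>j\<in>I. (v i \<bullet> v j) ^ 3) =
    c * (norm z)\<^sup>2 - 2 / M\<^sup>2 * ?N\<^sup>2 + ?N * (1 - (c - 2 / M\<^sup>2))" by simp
  have "3 * (norm z)\<^sup>2 \<le> (?D + 2) * (\<Sum>i\<in>I. \<Sum>j\<in>I. (v i \<bullet> v j) ^ 3)"
    using gegenbauer3_nonneg[of I v] assms(6) by (simp add: z_def add.commute)
  \<comment> \<open>Here the hypothesis on \<open>(D + 2) (M + 4)\<close> enters: it allows the
    \<open>|z|^2\<close> terms to be dropped from the degree 3 inequality.\<close>
  moreover have "(?D + 2) * c * (norm z)\<^sup>2 \<le> 3 * (norm z)\<^sup>2"
  proof (rule mult_right_mono)
    have "(?D + 2) * c = (?D + 2) * (M + 4) / M\<^sup>2"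
      using M(2) by (simp add: c_def field_simps power2_eq_square)
    also have "\<dots> \<le> 3" using assms(5) M(2) by (simp add: field_simps)
    finally show "(?D + 2) * c \<le> 3" .
  qed auto
  ultimately have "(?D + 2) * (?N * (2 / M\<^sup>2 * ?N)) \<le> (?D + 2) * (?N * (1 - (c - 2 / M\<^sup>2)))"
    unfolding sum3 by (simp add: algebra_simps power2_eq_square)
  then have "2 / M\<^sup>2 * ?N \<le> 1 - (c - 2 / M\<^sup>2)"
    by (rule mult_left_le_imp_le[OF mult_left_le_imp_le N]) simp
  then have "2 / M\<^sup>2 * ?N * M\<^sup>2 \<le> (1 - (c - 2 / M\<^sup>2)) * M\<^sup>2"
    by (intro mult_right_mono) auto
  also have "(1 - (c - 2 / M\<^sup>2)) * M\<^sup>2 = (M + 1) * (M - 2)"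
    using M(2) by (simp add: c_def field_simps power2_eq_square)
  finally show ?thesis using M(2) by simp
qed

text \<open>For \<open>D \<ge> M\<close> the matrix \<open>Q c = |\<Sum> c\<^sub>i v\<^sub>i|\<^sup>2 - \<rho> (\<Sum> c\<^sub>i)\<^sup>2\<close> has at most \<open>D\<close> positive eigenvalues, none
  of which exceeds \<open>q\<^sup>2 / 2\<close>; its trace \<open>N (1 - \<rho>)\<close> is therefore at most \<open>D q\<^sup>2 / 2\<close>.\<close>

lemma derived_family_trace_bound:
  fixes v :: "'i \<Rightarrow> 'e::euclidean_space" and q M :: real
  defines "M \<equiv> q\<^sup>2 - 1"
  assumes "finite I" "q > 1" "M \<le> DIM('e)"
    and "\<And>i. i \<in> I \<Longrightarrow> norm (v i) = 1"
    and "\<And>i j. i \<in> I \<Longrightarrow> j \<in> I \<Longrightarrow> i \<noteq> j \<Longrightarrow> v i \<bullet> v j = 1 / (q + 1) \<or> v i \<bullet> v j = - 1 / (q - 1)"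
  shows "real (card I) * (DIM('e) + M) \<le> (DIM('e))\<^sup>2 * (M + 1)"
proof -
  let ?N = "real (card I)" and ?D = "real DIM('e)" and ?B = "Basis :: 'e set"
  have M1: "M = (q + 1) * (q - 1)" by (simp add: M_def power2_eq_square algebra_simps)
  have "M > 0" unfolding M1 using assms(3) by simp
  note M = M1 this
  \<comment> \<open>Once the degree 2 inequality is multiplied by \<open>M\<close>, the squared sum
    of the \<open>c i\<close> is left with the coefficient
    \<open>1 - M / D = 2 \<rho>\<close>.\<close>
  define \<rho> where "\<rho> = (1 - M / ?D) / 2"
  have \<rho>: "\<rho> \<ge> 0" using assms(4) by (simp add: \<rho>_def)
  have form_le: "(norm (\<Sum>i\<in>I. c i *\<^sub>R v i))\<^sup>2 - \<rho> * (\<Sum>i\<in>I. c i)\<^sup>2 \<le> (M + 1) / 2 * (\<Sum>i\<in>I. (c i)\<^sup>2)" for c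
  proof -
    \<comment> \<open>The two inner products have sum \<open>- 2 / M\<close> and product
      \<open>- 1 / M\<close>, so they are the roots of this quadratic.\<close>
    have quad: "t\<^sup>2 = (1 - 2 * t) / M" if "t = 1 / (q + 1) \<or> t = - 1 / (q - 1)" for t
      using that
    proof
      assume t: "t = 1 / (q + 1)"
      define s where "s = q + 1"
      have "s \<noteq> 0" "s - 2 \<noteq> 0" "M = s * (s - 2)" "t = 1 / s"
        using assms(3) t by (auto simp: s_def M)
      then show ?thesis
        by (simp add: divide_simps power2_eq_square) algebra
    next
      assume t: "t = - 1 / (q - 1)"
      define s where "s = q - 1"
      have "s \<noteq> 0" "s + 2 \<noteq> 0" "M = s * (s + 2)" "t = - 1 / s"
        using assms(3) t by (auto simp: s_def M)
      then show ?thesis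
        by (simp add: divide_simps power2_eq_square) algebra
    qed
    have "(\<Sum>i\<in>I. \<Sum>j\<in>I. c i * c j * (v i \<bullet> v j)\<^sup>2) = 
        (\<Sum>i\<in>I. \<Sum>j\<in>I. c i * c j * ((1 - 2 * (v i \<bullet> v j)) / M))
      + (\<Sum>i\<in>I. c i * c i * (v i \<bullet> v i)\<^sup>2 - c i * c i * ((1 - 2 * (v i \<bullet> v i)) / M))"
      using quad assms(6) by (intro sum_over_pairs_diag assms(2)) (metis (no_types))
    also have "(\<Sum>i\<in>I. c i * c i * (v i \<bullet> v i)\<^sup>2 - c i * c i * ((1 - 2 * (v i \<bullet> v i)) / M)) =
      (\<Sum>i\<in>I. (1 + 1 / M) * (c i)\<^sup>2)"
      using assms(5) by (intro sum.cong) (auto simp: norm_eq_1 power2_eq_square field_simps)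
    also have "(\<Sum>i\<in>I. \<Sum>j\<in>I. c i * c j * ((1 - 2 * (v i \<bullet> v j)) / M)) =
        ((\<Sum>i\<in>I. \<Sum>j\<in>I. c i * c j) - 2 * (\<Sum>i\<in>I. \<Sum>j\<in>I. c i * c j * (v i \<bullet> v j))) / M"
      by (simp add: sum_subtractf sum_distrib_left sum_divide_distrib diff_divide_distrib algebra_simps)
    also have "\<dots> = ((\<Sum>i\<in>I. c i)\<^sup>2 - 2 * (norm (\<Sum>i\<in>I. c i *\<^sub>R v i))\<^sup>2) / M"
      by (simp only: sum_mult_inner) (simp add: power2_eq_square sum_product)
    also have "(\<Sum>i\<in>I. (1 + 1 / M) * (c i)\<^sup>2) = (1 + 1 / M) * (\<Sum>i\<in>I. (c i)\<^sup>2)"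
      by (simp add: sum_distrib_left)
    finally have "(\<Sum>i\<in>I. c i)\<^sup>2 \<le> ?D * (((\<Sum>i\<in>I. c i)\<^sup>2 - 2 * (norm (\<Sum>i\<in>I. c i *\<^sub>R v i))\<^sup>2) / M
        + (1 + 1 / M) * (\<Sum>i\<in>I. (c i)\<^sup>2))"
      using gegenbauer2_nonneg[of I v c] assms(5) by simp
    then have "(\<Sum>i\<in>I. c i)\<^sup>2 / ?D \<le> ((\<Sum>i\<in>I. c i)\<^sup>2 - 2 * (norm (\<Sum>i\<in>I. c i *\<^sub>R v i))\<^sup>2) / M
        + (1 + 1 / M) * (\<Sum>i\<in>I. (c i)\<^sup>2)"
      by (simp add: divide_le_eq mult.commute)
    then have "(\<Sum>i\<in>I. c i)\<^sup>2 / ?D * M \<le> (((\<Sum>i\<in>I. c i)\<^sup>2 - 2 * (norm (\<Sum>i\<in>I. c i *\<^sub>R v i))\<^sup>2) / M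
        + (1 + 1 / M) * (\<Sum>i\<in>I. (c i)\<^sup>2)) * M"
      using M(2) by (intro mult_right_mono) auto
    also have "\<dots> = (\<Sum>i\<in>I. c i)\<^sup>2 - 2 * (norm (\<Sum>i\<in>I. c i *\<^sub>R v i))\<^sup>2 + (M + 1) * (\<Sum>i\<in>I. (c i)\<^sup>2)"
      using M(2) by (simp add: field_simps)
    finally show ?thesis by (simp add: \<rho>_def algebra_simps diff_divide_distrib add_divide_distrib)
  qed
  \<comment> \<open>In place of eigenvectors: an orthonormal family whose span contains the
    coordinate functions, on which the first part of \<open>Q\<close> already has its full
    trace.\<close>
  obtain V where V: "finite V" "card V \<le> card ?B"
    "\<And>u w. u \<in> V \<Longrightarrow> w \<in> V \<Longrightarrow> (\<Sum>i\<in>I. u i * w i) = (if u = w then 1 else 0)"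
    "\<And>p i. p \<in> ?B \<Longrightarrow> i \<in> I \<Longrightarrow> v i \<bullet> p = (\<Sum>u\<in>V. (\<Sum>i\<in>I. (v i \<bullet> p) * u i) * u i)"
    using orthonormal_functions_exist[of ?B I "\<lambda>p i. v i \<bullet> p", OF finite_Basis assms(2)] by blast
  have "(\<Sum>u\<in>V. (norm (\<Sum>i\<in>I. u i *\<^sub>R v i))\<^sup>2) = (\<Sum>u\<in>V. \<Sum>p\<in>?B. (\<Sum>i\<in>I. (v i \<bullet> p) * u i)\<^sup>2)"
    unfolding power2_norm_eq_inner
    by (subst euclidean_inner) (simp add: inner_sum_left power2_eq_square mult_ac)
  also have "\<dots> = (\<Sum>p\<in>?B. \<Sum>u\<in>V. (\<Sum>i\<in>I. (v i \<bullet> p) * u i)\<^sup>2)"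
    by (rule sum.swap)
  also have "\<dots> = (\<Sum>p\<in>?B. \<Sum>i\<in>I. (v i \<bullet> p)\<^sup>2)"
    using V(4) by (intro sum.cong refl bessel_inequality_functions(2) V(1,3))
  also have "\<dots> = (\<Sum>i\<in>I. \<Sum>p\<in>?B. (v i \<bullet> p)\<^sup>2)"
    by (rule sum.swap)
  also have "\<dots> = (\<Sum>i\<in>I. (norm (v i))\<^sup>2)"
    unfolding power2_norm_eq_inner by (subst (2) euclidean_inner) (simp add: power2_eq_square)
  also have "\<dots> = ?N" using assms(5) by simp
  finally have trace: "(\<Sum>u\<in>V. (norm (\<Sum>i\<in>I. u i *\<^sub>R v i))\<^sup>2) = ?N" .
  \<comment> \<open>Bessel for the constant function 1; as \<open>\<rho> \<ge> 0\<close>, the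
    subtracted part of \<open>Q\<close> costs at most \<open>\<rho> N\<close>.\<close>
  have bessel: "(\<Sum>u\<in>V. (\<Sum>i\<in>I. u i)\<^sup>2) \<le> ?N"
  proof -
    have "(\<Sum>u\<in>V. (\<Sum>i\<in>I. 1 * u i)\<^sup>2) \<le> (\<Sum>i\<in>I. 1\<^sup>2)"
      by (intro bessel_inequality_functions(1) V(1,3))
    then show ?thesis by simp
  qed
  have "?N * (1 - \<rho>) = ?N - \<rho> * ?N" by (simp add: algebra_simps)
  also have "\<dots> \<le> ?N - \<rho> * (\<Sum>u\<in>V. (\<Sum>i\<in>I. u i)\<^sup>2)"
    using bessel \<rho> by (simp add: mult_left_mono)
  also have "\<dots> = (\<Sum>u\<in>V. (norm (\<Sum>i\<in>I. u i *\<^sub>R v i))\<^sup>2 - \<rho> * (\<Sum>i\<in>I. u i)\<^sup>2)"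
    by (simp add: sum_subtractf trace sum_distrib_left)
  also have "\<dots> \<le> (\<Sum>u\<in>V. (M + 1) / 2 * (\<Sum>i\<in>I. (u i)\<^sup>2))"
    by (intro sum_mono form_le)
  also have "\<dots> = (M + 1) / 2 * card V"
    using V(3) by (simp add: power2_eq_square)
  also have "\<dots> \<le> (M + 1) / 2 * ?D"
    using V(2) M(2) by (intro mult_left_mono) auto
  finally have "?N * (1 - \<rho>) * (2 * ?D) \<le> (M + 1) / 2 * ?D * (2 * ?D)"
    by (intro mult_right_mono) auto
  moreover have "(1 - \<rho>) * (2 * ?D) = ?D + M"
    by (simp add: \<rho>_def field_simps)
  ultimately show ?thesis by (simp add: power2_eq_square mult.assoc) (simp add: mult_ac)
qed

section \<open>Inner products of a spherical two-distance set, and the case of nonnegative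
  sum\<close>

lemma dist_sphere_power2:
  fixes x y :: "'e::real_inner"
  assumes "norm x = 1" "norm y = 1"
  shows "(dist x y)\<^sup>2 = 2 - 2 * (x \<bullet> y)"
  using assms by (simp add: dist_norm power2_norm_eq_inner norm_eq_1 inner_diff_left inner_diff_right inner_commute)

lemma two_distance_set_inner_products:
  fixes S :: "'e::real_inner set"
  assumes "S \<subseteq> sphere 0 1" "two_distance_set S"
  obtains a b :: real where "b < a" "a < 1"
    "\<And>x y. x \<in> S \<Longrightarrow> y \<in> S \<Longrightarrow> x \<noteq> y \<Longrightarrow> x \<bullet> y = a \<or> x \<bullet> y = b"
proof -
  obtain d e where de: "distances S = {d, e}" "d \<noteq> e"
    using assms(2) unfolding two_distance_set_def by (auto simp: card_2_iff)
  have pos: "d > 0" "e > 0"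
  proof -
    have "t > 0" if "t \<in> distances S" for t
      using that by (auto simp: distances_def)
    then show "d > 0" "e > 0" by (auto simp: de)
  qed
  \<comment> \<open>The larger inner product belongs to the smaller distance, whose positivity gives
    \<open>a < 1\<close>.\<close>
  define a b where "a = 1 - (min d e)\<^sup>2 / 2" and "b = 1 - (max d e)\<^sup>2 / 2"
  show thesis
  proof (rule that)
    have "(min d e)\<^sup>2 < (max d e)\<^sup>2"
      using pos de(2) by (intro power_strict_mono) auto
    then show "b < a" by (simp add: a_def b_def)
    show "a < 1" using pos by (simp add: a_def min_def)
    show "x \<bullet> y = a \<or> x \<bullet> y = b" if "x \<in> S" "y \<in> S" "x \<noteq> y" for x y
    proof -
      have "dist x y \<in> {d, e}" using that unfolding de(1)[symmetric] distances_def by blast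
      then have "dist x y = min d e \<or> dist x y = max d e" by auto
      moreover have "x \<bullet> y = 1 - (dist x y)\<^sup>2 / 2"
        using dist_sphere_power2[of x y] subsetD[OF assms(1) that(1)] subsetD[OF assms(1) that(2)]
        by (simp add: diff_divide_distrib)
      ultimately show ?thesis by (auto simp: a_def b_def)
    qed
  qed
qed

text \<open>Quadratic forms restricted to \<open>S\<close> span at most \<open>n (n + 1) / 2\<close>
  dimensions; a larger \<open>S\<close> would carry nonzero weights annihilating them all, which the
  sign of \<open>a + b\<close> rules out.\<close>

lemma card_two_inner_products_nonneg_sum:
  fixes S :: "'e::euclidean_space set"
  assumes "finite S" "S \<subseteq> sphere 0 1" "a < 1" "b < 1" "a + b \<ge> 0"
    and ab: "\<And>x y. x \<in> S \<Longrightarrow> y \<in> S \<Longrightarrow> x \<noteq> y \<Longrightarrow> x \<bullet> y = a \<or> x \<bullet> y = b"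
  shows "2 * card S \<le> DIM('e) * (DIM('e) + 1)"
proof (rule ccontr)
  assume large: "\<not> ?thesis"
  let ?B = "Basis :: 'e set"
  \<comment> \<open>By polarization the squares of \<open>x \<bullet> p\<close> and
    \<open>x \<bullet> (p + q)\<close> span all quadratic forms, so one equation for each set of one
    or two basis vectors suffices.\<close>
  define K where "K = {P. P \<subseteq> ?B \<and> card P = 1} \<union> {P. P \<subseteq> ?B \<and> card P = 2}"
  have "card K = card {P. P \<subseteq> ?B \<and> card P = 1} + card {P. P \<subseteq> ?B \<and> card P = 2}"
    unfolding K_def by (intro card_Un_disjoint) (auto intro: finite_subset[of _ "Pow ?B"])
  also have "\<dots> = DIM('e) + (DIM('e) choose 2)"
    by (simp add: n_subsets)
  finally have "2 * card K = DIM('e) * (DIM('e) + 1)"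
    by (cases "DIM('e)") (auto simp: choose_two algebra_simps)
  with large have "card K < card S" by linarith
  moreover have "finite K" unfolding K_def by (auto intro: finite_subset[of _ "Pow ?B"])
  ultimately obtain c x0 where x0: "x0 \<in> S" "c x0 \<noteq> 0"
    and c: "\<And>P. P \<in> K \<Longrightarrow> (\<Sum>x\<in>S. (x \<bullet> \<Sum>P)\<^sup>2 * c x) = 0"
    using homogeneous_system_nontrivial_solution[of K S "\<lambda>P x. (x \<bullet> \<Sum>P)\<^sup>2"] assms(1) by blast
  have diag: "(\<Sum>x\<in>S. c x * (x \<bullet> p) * (x \<bullet> p)) = 0" if "p \<in> ?B" for p
    using c[of "{p}"] that by (simp add: K_def power2_eq_square mult_ac)
  have moment: "(\<Sum>x\<in>S. c x * (x \<bullet> p) * (x \<bullet> q)) = 0" if "p \<in> ?B" "q \<in> ?B" for p q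
  proof (cases "p = q")
    case False
    then have "0 = (\<Sum>x\<in>S. (x \<bullet> (p + q))\<^sup>2 * c x)"
      using c[of "{p, q}"] that by (simp add: K_def)
    also have "\<dots> = (\<Sum>x\<in>S. c x * (x \<bullet> p) * (x \<bullet> p)) + (\<Sum>x\<in>S. c x * (x \<bullet> q) * (x \<bullet> q))
       + 2 * (\<Sum>x\<in>S. c x * (x \<bullet> p) * (x \<bullet> q))"
      by (simp add: sum_distrib_left power2_eq_square algebra_simps flip: sum.distrib)
    finally show ?thesis using diag that by simp
  qed (use diag that in simp)
  \<comment> \<open>The diagonal moments add up to the sum of \<open>c x |x|^2\<close>; its
    vanishing removes the \<open>a * b\<close> term below.\<close>
  have c0: "(\<Sum>x\<in>S. c x) = 0"
  proof -
    have "(\<Sum>x\<in>S. c x) = (\<Sum>x\<in>S. c x * (x \<bullet> x))"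
      using assms(2) by (intro sum.cong) (auto simp: norm_eq_1)
    also have "\<dots> = (\<Sum>x\<in>S. \<Sum>p\<in>?B. c x * (x \<bullet> p) * (x \<bullet> p))"
      by (subst euclidean_inner) (simp add: sum_distrib_left algebra_simps)
    also have "\<dots> = (\<Sum>p\<in>?B. \<Sum>x\<in>S. c x * (x \<bullet> p) * (x \<bullet> p))" by (rule sum.swap)
    finally show ?thesis using diag by simp
  qed
  have "0 = (\<Sum>x\<in>S. \<Sum>y\<in>S. c x * c y * (x \<bullet> y)\<^sup>2)"
    using sum_mult_inner_power2[of c "\<lambda>x. x" S] moment by simp
  also have "\<dots> = (\<Sum>x\<in>S. \<Sum>y\<in>S. c x * c y * ((a + b) * (x \<bullet> y) - a * b))
    + (\<Sum>x\<in>S. c x * c x * (x \<bullet> x)\<^sup>2 - c x * c x * ((a + b) * (x \<bullet> x) - a * b))"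
  proof (intro sum_over_pairs_diag assms(1))
    fix x y assume "x \<in> S" "y \<in> S" "x \<noteq> y"
    then have "(x \<bullet> y)\<^sup>2 = (a + b) * (x \<bullet> y) - a * b"
      using ab[of x y] by (auto simp: power2_eq_square algebra_simps)
    then show "c x * c y * (x \<bullet> y)\<^sup>2 = c x * c y * ((a + b) * (x \<bullet> y) - a * b)" by simp
  qed
  also have "(\<Sum>x\<in>S. c x * c x * (x \<bullet> x)\<^sup>2 - c x * c x * ((a + b) * (x \<bullet> x) - a * b)) =
     (\<Sum>x\<in>S. (1 - a) * (1 - b) * (c x)\<^sup>2)"
    using assms(2) by (intro sum.cong) (auto simp: norm_eq_1 power2_eq_square algebra_simps)
  also have "(\<Sum>x\<in>S. \<Sum>y\<in>S. c x * c y * ((a + b) * (x \<bullet> y) - a * b)) =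
     (a + b) * (\<Sum>x\<in>S. \<Sum>y\<in>S. c x * c y * (x \<bullet> y)) - a * b * (\<Sum>x\<in>S. \<Sum>y\<in>S. c x * c y)"
    by (simp add: sum_distrib_left algebra_simps flip: sum_subtractf sum.distrib)
  also have "\<dots> = (a + b) * (norm (\<Sum>x\<in>S. c x *\<^sub>R x))\<^sup>2 - a * b * ((\<Sum>x\<in>S. c x) * (\<Sum>x\<in>S. c x))"
    by (simp only: sum_mult_inner sum_product)
  finally have "(a + b) * (norm (\<Sum>x\<in>S. c x *\<^sub>R x))\<^sup>2 + (\<Sum>x\<in>S. (1 - a) * (1 - b) * (c x)\<^sup>2) = 0"
    by (simp add: c0)
  moreover have "(\<Sum>x\<in>S. (1 - a) * (1 - b) * (c x)\<^sup>2) > 0"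
    using assms(1,3,4) x0 by (intro sum_pos2[of _ x0]) auto
  moreover have "(a + b) * (norm (\<Sum>x\<in>S. c x *\<^sub>R x))\<^sup>2 \<ge> 0" using assms(5) by simp
  ultimately show False by linarith
qed

section \<open>Integrality of the ratio of inner products\<close>

text \<open>If \<open>\<delta>\<close> is the fractional part of the eigenvalue, the powers \<open>\<delta>\<^sup>r\<close> times an entry of the eigenvector
  are integers tending to \<open>0\<close>.\<close>

lemma eigenvalue_of_integer_eigenvector_Ints:
  fixes A :: "'t \<Rightarrow> 't \<Rightarrow> int" and v :: "'t \<Rightarrow> int" and \<kappa> :: real
  assumes "t0 \<in> T" "v t0 \<noteq> 0"
    and "\<And>i. i \<in> T \<Longrightarrow> (\<Sum>j\<in>T. real_of_int (A i j) * v j) = \<kappa> * v i"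
  shows "\<kappa> \<in> \<int>"
proof (rule ccontr)
  assume "\<kappa> \<notin> \<int>"
  define \<delta> where "\<delta> = frac \<kappa>"
  have \<delta>: "0 < \<delta>" "\<delta> < 1"
    using \<open>\<kappa> \<notin> \<int>\<close> by (auto simp: \<delta>_def frac_lt_1)
  have int: "\<delta> ^ r * v i \<in> \<int>" if "i \<in> T" for r i
    using that
  proof (induction r arbitrary: i)
    case (Suc r)
    have "\<delta> ^ Suc r * v i = \<delta> ^ r * (\<kappa> * v i) - \<lfloor>\<kappa>\<rfloor> * (\<delta> ^ r * v i)"
      by (simp add: \<delta>_def frac_def algebra_simps)
    also have "\<dots> = (\<Sum>j\<in>T. A i j * (\<delta> ^ r * v j)) - \<lfloor>\<kappa>\<rfloor> * (\<delta> ^ r * v i)"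
      unfolding assms(3)[OF Suc.prems, symmetric] sum_distrib_left by (simp add: mult_ac)
    also have "\<dots> \<in> \<int>"
      by (intro Ints_diff Ints_sum Ints_mult[OF Ints_of_int] Suc)
    finally show ?case .
  qed auto
  obtain r where "\<delta> ^ r < 1 / \<bar>v t0\<bar>"
    using real_arch_pow_inv[of "1 / \<bar>v t0\<bar>" \<delta>] \<delta> assms(2) by auto
  then have "\<bar>\<delta> ^ r * v t0\<bar> < 1"
    using \<delta> assms(2) by (simp add: abs_mult field_simps)
  moreover have "\<bar>\<delta> ^ r * v t0\<bar> \<ge> 1"
    using int[OF assms(1), of r] \<delta> assms(2) by (intro Ints_nonzero_abs_ge1) auto
  ultimately show False by simp
qed

text \<open>This is the theorem of Larman, Rogers and Seidel. The graph of the pairs with inner product \<open>a\<close> has an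
  adjacency matrix \<open>A\<close> for which \<open>A + \<kappa> I\<close> has rank at most \<open>n + 1\<close>. Off the rows of a basis there is room
  for an integer vector that these rows, restricted to its support, annihilate; the diagonal \<open>\<kappa>\<close> does not
  enter in those equations, and the vector is an eigenvector for \<open>- \<kappa>\<close>.\<close>

lemma two_inner_products_ratio_Ints:
  fixes S :: "'e::euclidean_space set"
  assumes "finite S" "S \<subseteq> sphere 0 1" "b < a" "a < 1" "2 * DIM('e) + 3 \<le> card S"
    and ab: "\<And>x y. x \<in> S \<Longrightarrow> y \<in> S \<Longrightarrow> x \<noteq> y \<Longrightarrow> x \<bullet> y = a \<or> x \<bullet> y = b"
  shows "(1 - b) / (a - b) \<in> \<int>"
proof -
  \<comment> \<open>The extra coordinate 1 writes \<open>x \<bullet> y - b\<close> as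
    \<open>L x \<bullet> (y, - b)\<close>, so the matrix of these entries has rank at most
    \<open>DIM('e) + 1\<close>.\<close>
  define L :: "'e \<Rightarrow> 'e \<times> real" where "L x = (x, 1)" for x
  obtain B where B: "B \<subseteq> L ` S" "independent B" "L ` S \<subseteq> span B"
    using maximal_independent_subset[of "L ` S"] by metis
  define R where "R = {x \<in> S. L x \<in> B}"
  define T where "T = S - R"
  have "inj L" by (auto simp: L_def inj_def)
  have "L ` R = B" using B(1) by (auto simp: R_def)
  then have "card R = card B"
    using card_image[OF inj_on_subset[OF \<open>inj L\<close>], of R] by simp
  also have "\<dots> \<le> DIM('e) + 1"
    using independent_bound[OF B(2)] by simp
  finally have R: "card R \<le> DIM('e) + 1" "finite R" using assms(1) by (auto simp: R_def)
  have fin: "finite T" using assms(1) by (simp add: T_def)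
  have "card T = card S - card R"
    unfolding T_def using R by (intro card_Diff_subset) (auto simp: R_def)
  \<comment> \<open>At most \<open>DIM('e) + 1\<close> points are in \<open>R\<close>, so the
    assumed \<open>2 * DIM('e) + 3\<close> points leave at least \<open>DIM('e) + 2\<close> in
    \<open>T\<close>.\<close>
  then have "card R < card T" using R assms(5) by linarith
  define A :: "'e \<Rightarrow> 'e \<Rightarrow> int" where "A x y = (if x \<noteq> y \<and> x \<bullet> y = a then 1 else 0)" for x y
  obtain v t0 where v: "t0 \<in> T" "v t0 \<noteq> 0" "\<And>x. x \<in> R \<Longrightarrow> (\<Sum>y\<in>T. A x y * v y) = 0"
    using homogeneous_system_nontrivial_solution[of R T A, OF R(2) fin \<open>card R < card T\<close>] by blast
  have entry: "x \<bullet> y - b = (a - b) * A x y" if "x \<in> S" "y \<in> S" "x \<noteq> y" for x y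
    using ab[OF that] that assms(3) by (auto simp: A_def)
  define w where "w = (\<Sum>y\<in>T. real_of_int (v y) *\<^sub>R (y, - b))"
  have Lw: "L x \<bullet> w = (\<Sum>y\<in>T. v y * (x \<bullet> y - b))" for x
    by (simp add: w_def L_def inner_sum_right right_diff_distrib)
  have "L x \<bullet> w = 0" if "x \<in> R" for x
  proof -
    have "L x \<bullet> w = (\<Sum>y\<in>T. v y * ((a - b) * A x y))"
      unfolding Lw using that entry[of x] by (intro sum.cong) (auto simp: T_def R_def)
    also have "\<dots> = (a - b) * real_of_int (\<Sum>y\<in>T. A x y * v y)"
      by (simp add: sum_distrib_left mult_ac)
    finally show ?thesis using v(3)[OF that] by simp
  qed
  \<comment> \<open>Orthogonality to the basis \<open>B\<close> extends to its span, which contains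
    every \<open>L x\<close>: the relation known for the rows in \<open>R\<close> passes to those in
    \<open>T\<close>.\<close>
  then have "\<forall>u\<in>B. u \<bullet> w = 0" using \<open>L ` R = B\<close> by auto
  then have "u \<bullet> w = 0" if "u \<in> span B" for u
    using that by (metis orthogonal_def orthogonal_to_span inner_commute)
  then have w0: "L x \<bullet> w = 0" if "x \<in> S" for x
    using subsetD[OF B(3) imageI[OF that]] by blast
  \<comment> \<open>For rows in \<open>T\<close> the diagonal enters:
    \<open>x \<bullet> x - b = 1 - b\<close> while \<open>A x x = 0\<close>, and this produces the
    eigenvalue.\<close>
  have "(\<Sum>y\<in>T. real_of_int (A x y) * v y) = - ((1 - b) / (a - b)) * v x" if "x \<in> T" for x
  proof -
    have x: "x \<in> S" "x \<bullet> x = 1" "A x x = 0" using that assms(2) by (auto simp: T_def A_def norm_eq_1)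
    have "(\<Sum>y\<in>T. v y * (x \<bullet> y - b)) = v x * (1 - b) + (\<Sum>y\<in>T - {x}. v y * (x \<bullet> y - b))"
      using that fin x(2) by (simp add: sum.remove[of T x])
    also have "(\<Sum>y\<in>T - {x}. v y * (x \<bullet> y - b)) = (\<Sum>y\<in>T - {x}. (a - b) * (A x y * v y))"
      using entry[of x] x(1) by (intro sum.cong) (auto simp: T_def)
    also have "\<dots> = (\<Sum>y\<in>T. (a - b) * (A x y * v y))"
      using that fin x(3) by (simp add: sum.remove[of T x])
    finally have "(a - b) * (\<Sum>y\<in>T. real_of_int (A x y) * v y) = - (v x * (1 - b))"
      using w0[OF x(1)] unfolding Lw sum_distrib_left of_int_mult by linarith
    then show ?thesis using assms(3) by (simp add: field_simps)
  qed
  then have "- ((1 - b) / (a - b)) \<in> \<int>"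
    by (intro eigenvalue_of_integer_eigenvector_Ints[where A = A and v = v, OF v(1,2)])
  then show ?thesis by (metis Ints_minus minus_minus)
qed

section \<open>The equiangular lift and the upper bound\<close>

text \<open>The map taking \<open>t\<close> to \<open>1 - 2 (1 - t) / u\<close> fixes 1 and sends
  \<open>a\<close> and \<open>b\<close> to opposite values; scaling the points and appending a
  constant coordinate realizes it. The sign of \<open>a + b\<close> keeps \<open>1 - 2 / u\<close>
  nonnegative under the root.\<close>

lemma two_inner_products_equiangular_lift:
  fixes S :: "'e::euclidean_space set"
  assumes "S \<subseteq> sphere 0 1" "b < a" "a < 1" "a + b \<le> 0"
    and ab: "\<And>x y. x \<in> S \<Longrightarrow> y \<in> S \<Longrightarrow> x \<noteq> y \<Longrightarrow> x \<bullet> y = a \<or> x \<bullet> y = b"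
  obtains f :: "'e \<Rightarrow> 'e \<times> real" where "\<And>x. x \<in> S \<Longrightarrow> norm (f x) = 1"
    "\<And>x y. x \<in> S \<Longrightarrow> y \<in> S \<Longrightarrow> x \<noteq> y \<Longrightarrow> \<bar>f x \<bullet> f y\<bar> = 1 / (2 * ((1 - b) / (a - b)) - 1)"
proof
  define u where "u = 2 - a - b"
  have u: "u > 0" "u \<ge> 2" using assms by (auto simp: u_def)
  define f :: "'e \<Rightarrow> 'e \<times> real" where "f x = (sqrt (2 / u) *\<^sub>R x, sqrt (1 - 2 / u))" for x
  have f: "f x \<bullet> f y = 1 - 2 * (1 - x \<bullet> y) / u" for x y
  proof -
    have "f x \<bullet> f y = sqrt (2 / u) * sqrt (2 / u) * (x \<bullet> y) + sqrt (1 - 2 / u) * sqrt (1 - 2 / u)"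
      by (simp add: f_def mult_ac)
    also have "\<dots> = 2 / u * (x \<bullet> y) + (1 - 2 / u)"
      using u by (subst (1 2) real_sqrt_mult_self) auto
    finally show ?thesis by (simp add: diff_divide_distrib right_diff_distrib)
  qed
  show "norm (f x) = 1" if "x \<in> S" for x
    using that assms(1) by (auto simp: norm_eq_1 f)
  show "\<bar>f x \<bullet> f y\<bar> = 1 / (2 * ((1 - b) / (a - b)) - 1)" if "x \<in> S" "y \<in> S" "x \<noteq> y" for x y
  proof -
    have "2 * ((1 - b) / (a - b)) - 1 = u / (a - b)"
      using assms(2) by (simp add: u_def field_simps)
    moreover have "f x \<bullet> f y = (a - b) / u \<or> f x \<bullet> f y = - (a - b) / u"
      using ab[OF that] u(1) unfolding f by (auto simp: u_def field_simps)
    ultimately show ?thesis using u(1) assms(2) by auto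
  qed
qed

text \<open>The cases compare \<open>q^2\<close> with \<open>n\<close>. At the excluded value
  \<open>q^2 = n + 3\<close> the relative bound in dimension \<open>n + 1\<close> yields only
  \<open>(n + 1) (n + 2) / 2\<close>.\<close>

lemma card_equiangular_odd:
  fixes y :: "'i \<Rightarrow> 'e::euclidean_space" and k n :: nat
  assumes "finite I" "DIM('e) = n + 1" "n \<ge> 7" "k \<ge> 2" "(2 * k - 1)\<^sup>2 \<noteq> n + 3"
    and "\<And>i. i \<in> I \<Longrightarrow> norm (y i) = 1"
    and "\<And>i j. i \<in> I \<Longrightarrow> j \<in> I \<Longrightarrow> i \<noteq> j \<Longrightarrow> \<bar>y i \<bullet> y j\<bar> = 1 / (2 * real k - 1)"
  shows "2 * card I \<le> n * (n + 1)"
proof (cases "I = {}")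
  case False
  then obtain i0 where i0: "i0 \<in> I" by blast
  define N where "N = real (card I)"
  define x where "x = real n"
  define q where "q = 2 * real k - 1"
  define M where "M = q\<^sup>2 - 1"
  have q: "q \<ge> 3" "q = real (2 * k - 1)" using assms(4) by (auto simp: q_def)
  have "q\<^sup>2 \<ge> 3\<^sup>2" using q(1) by (intro power_mono) auto
  then have M8: "M \<ge> 8" by (simp add: M_def)
  have x7: "x \<ge> 7" using assms(3) by (simp add: x_def)
  have D: "real DIM('e) = x + 1" using assms(2) by (simp add: x_def)
  have card': "real (card (I - {i0})) = N - 1"
    using i0 assms(1) by (simp add: N_def card_Diff_singleton) 
      (metis One_nat_def Suc_leI card_gt_0_iff empty_iff of_nat_1 of_nat_diff)
  have M1: "M + 1 = real ((2 * k - 1)\<^sup>2)" by (simp add: M_def q(2))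
  have "2 * N \<le> x * (x + 1)"
  proof (cases "(2 * k - 1)\<^sup>2 \<ge> n + 4")
    case True
    then have "real (n + 4) \<le> real ((2 * k - 1)\<^sup>2)" by (simp only: of_nat_le_iff)
    then have "M \<ge> x + 3" unfolding M1[symmetric] by (simp add: x_def)
    have "N * (M + 1 - (x + 1)) \<le> (x + 1) * M"
      using equiangular_relative_bound[OF assms(1) False _ assms(6,7)] q(1)
      by (simp add: q_def[symmetric] N_def D M_def)
    \<comment> \<open>With \<open>M - x \<ge> 3\<close> this means
      \<open>N \<le> (x + 1) (x + 3) / 3\<close>, which is at most \<open>x (x + 1) / 2\<close> from
      \<open>x = 6\<close> on.\<close>
    then have *: "(N - (x + 1)) * (M - x) \<le> (x + 1) * x"
      by (simp add: algebra_simps)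
    show ?thesis
    proof (rule ccontr)
      assume "\<not> ?thesis"
      then have N: "2 * N > x * (x + 1)" by simp
      have "x * x \<ge> 7 * x" using x7 by (intro mult_right_mono) auto
      then have "N - (x + 1) \<ge> 0" using N x7 \<open>x * x \<ge> 7 * x\<close> unfolding ring_distribs by linarith
      then have "(N - (x + 1)) * 3 \<le> (N - (x + 1)) * (M - x)"
        using \<open>M \<ge> x + 3\<close> by (intro mult_left_mono) auto
      then have "(N - (x + 1)) * 3 \<le> (x + 1) * x" using * by linarith
      then show False using N \<open>x * x \<ge> 7 * x\<close> x7 unfolding ring_distribs by linarith
    qed
  next
    case False
    then have "(2 * k - 1)\<^sup>2 \<le> n + 2" using assms(5) by linarith
    then have "real ((2 * k - 1)\<^sup>2) \<le> real (n + 2)" by (simp only: of_nat_le_iff)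
    then have Mx: "M \<le> x + 1" unfolding M1[symmetric] by (simp add: x_def)
    obtain v :: "'i \<Rightarrow> 'e" where v: "\<And>i. i \<in> I - {i0} \<Longrightarrow> norm (v i) = 1"
      "\<And>i j. i \<in> I - {i0} \<Longrightarrow> j \<in> I - {i0} \<Longrightarrow> i \<noteq> j \<Longrightarrow> v i \<bullet> v j = 1 / (q + 1) \<or> v i \<bullet> v j = - 1 / (q - 1)"
      using derived_two_distance_family[of q i0 I y] q(1) i0 assms(6,7) unfolding q_def by auto
    show ?thesis
    \<comment> \<open>Up to this threshold the hypothesis of the cubic bound follows from
      \<open>(M + 6) (M + 4) \<le> 3 M^2\<close>, true for \<open>M \<ge> 8\<close>; beyond it the
      trace bound takes over.\<close>
    proof (cases "x \<le> M + 3")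
      case True
      have "(M + 6) * (M + 4) \<le> 3 * M\<^sup>2"
      proof -
        have "M * M \<ge> 8 * M" using M8 by (intro mult_right_mono) auto
        then show ?thesis using M8 unfolding power2_eq_square ring_distribs by linarith
      qed
      moreover have "(x + 3) * (M + 4) \<le> (M + 6) * (M + 4)"
        using True M8 by (intro mult_right_mono) auto
      ultimately have "(x + 3) * (M + 4) \<le> 3 * M\<^sup>2" by (rule order_trans[rotated])
      moreover have dim2: "real (DIM('e) + 2) = x + 3" using D by simp
      ultimately have dim: "real (DIM('e) + 2) * (M + 4) \<le> 3 * M\<^sup>2" unfolding dim2 by blast
      have "2 * (N - 1) \<le> (M + 1) * (M - 2)"
      proof (cases "I - {i0} = {}")
        case True
        have "N - 1 = 0" using card' unfolding True by simp
        then show ?thesis using M8 by simp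
      next
        case False
        have "2 * real (card (I - {i0})) \<le> (M + 1) * (M - 2)"
          by (rule derived_family_cubic_bound[of "I - {i0}" q v, folded M_def, OF _ False _ dim])
            (use assms(1) q(1) v in auto)
        then show ?thesis unfolding card' .
      qed
      \<comment> \<open>Counting the removed vector again turns \<open>(M + 1) (M - 2)\<close> into
        \<open>M (M - 1)\<close>.\<close>
      then have "2 * N \<le> M * (M - 1)" by (simp add: algebra_simps)
      also have "\<dots> \<le> (x + 1) * x" using Mx M8 by (intro mult_mono) auto
      finally show ?thesis by (simp add: algebra_simps)
    next
      case False
      have "(N - 1) * (x + 1 + M) \<le> (x + 1)\<^sup>2 * (M + 1)"
        using derived_family_trace_bound[of "I - {i0}" q v] assms(1) q(1) D False v card'
        by (simp add: M_def)
      then have *: "2 * (N - 1) * (x + 1 + M) \<le> 2 * (x + 1)\<^sup>2 * (M + 1)"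
        unfolding mult.assoc by linarith
      show ?thesis
      proof (rule ccontr)
        assume "\<not> ?thesis"
        then have "x * (x + 1) - 2 < 2 * (N - 1)" by simp
        then have "(x * (x + 1) - 2) * (x + 1 + M) < 2 * (N - 1) * (x + 1 + M)"
          using x7 M8 by (intro mult_strict_right_mono) auto
        with * have "(x * (x + 1) - 2) * (x + 1 + M) < 2 * (x + 1)\<^sup>2 * (M + 1)" by linarith
        \<comment> \<open>The terms with the factor \<open>M + 1\<close> are collected; since
          \<open>M + 1 \<le> x - 2\<close>, what remains is the absurd
          \<open>x^3 + x^2 - 2 x < x^3 + x^2 - 2 x - 8\<close>.\<close>
        then have "x * (x * (x + 1) - 2) < (M + 1) * (x * x + 3 * x + 4)"
          by (simp add: power2_eq_square algebra_simps)
        also have "\<dots> \<le> (x - 2) * (x * x + 3 * x + 4)"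
          using False x7 by (intro mult_right_mono) auto
        finally show False using x7 by (simp add: algebra_simps)
      qed
    qed
  qed
  then have "real (2 * card I) \<le> real (n * (n + 1))" by (simp add: N_def x_def algebra_simps)
  then show ?thesis by (simp only: of_nat_le_iff)
qed auto

lemma card_spherical_two_distance_set_le:
  fixes S :: "'e::euclidean_space set"
  assumes "S \<subseteq> sphere 0 1" "two_distance_set S" "DIM('e) \<ge> 7"
    and "\<not> (\<exists>k::nat. int DIM('e) = (2 * int k + 1)\<^sup>2 - 3)"
  shows "2 * card S \<le> DIM('e) * (DIM('e) + 1)"
proof (rule ccontr)
  assume large: "\<not> ?thesis"
  have fin: "finite S" using assms(2) by (simp add: two_distance_set_def)
  obtain a b where ab: "b < a" "a < 1"
    "\<And>x y. x \<in> S \<Longrightarrow> y \<in> S \<Longrightarrow> x \<noteq> y \<Longrightarrow> x \<bullet> y = a \<or> x \<bullet> y = b"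
    using two_distance_set_inner_products[OF assms(1,2)] by metis
  have neg: "a + b < 0"
    using card_two_inner_products_nonneg_sum[OF fin assms(1) ab(2) _ _ ab(3)] ab(1,2) large
    by fastforce
  \<comment> \<open>For \<open>n \<ge> 7\<close>, more than \<open>n (n + 1) / 2\<close> points are
    at least the \<open>2 n + 3\<close> that integrality requires.\<close>
  have "7 * (DIM('e) + 1) \<le> DIM('e) * (DIM('e) + 1)"
    using assms(3) by (intro mult_right_mono) auto
  also have "\<dots> < 2 * card S" using large by simp
  finally have "2 * DIM('e) + 3 \<le> card S" by simp
  then have "(1 - b) / (a - b) \<in> \<int>"
    by (intro two_inner_products_ratio_Ints[OF fin assms(1) ab(1,2)] ab(3))
  moreover have "(1 - b) / (a - b) > 1" using ab by (simp add: field_simps)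
  ultimately obtain k :: nat where k: "(1 - b) / (a - b) = real k" "k \<ge> 2"
  proof -
    assume gt: "(1 - b) / (a - b) > 1" and int: "(1 - b) / (a - b) \<in> \<int>"
      and that: "\<And>k. (1 - b) / (a - b) = real k \<Longrightarrow> 2 \<le> k \<Longrightarrow> thesis"
    obtain z :: int where z: "(1 - b) / (a - b) = z" using int by (auto elim: Ints_cases)
    with gt have "z \<ge> 2" by simp
    then show thesis using z by (intro that[of "nat z"]) auto
  qed
  obtain f :: "'e \<Rightarrow> 'e \<times> real" where f: "\<And>x. x \<in> S \<Longrightarrow> norm (f x) = 1"
    "\<And>x y. x \<in> S \<Longrightarrow> y \<in> S \<Longrightarrow> x \<noteq> y \<Longrightarrow> \<bar>f x \<bullet> f y\<bar> = 1 / (2 * real k - 1)"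
    using two_inner_products_equiangular_lift[OF assms(1) ab(1,2) _ ab(3)] neg unfolding k(1)
    by (metis less_imp_le)
  \<comment> \<open>The excluded form is written with \<open>2 k + 1\<close>, so the hypothesis is
    used at \<open>k - 1\<close>.\<close>
  have "(2 * k - 1)\<^sup>2 \<noteq> DIM('e) + 3"
  proof
    assume "(2 * k - 1)\<^sup>2 = DIM('e) + 3"
    then have "(int (2 * k - 1))\<^sup>2 = int DIM('e) + 3" by (simp flip: of_nat_power)
    moreover have "int (2 * k - 1) = 2 * int (k - 1) + 1" using k(2) by simp
    ultimately show False using assms(4) by (auto dest!: spec[of _ "k - 1"])
  qed
  then show False
    using card_equiangular_odd[of S "DIM('e)" k f] fin f assms(3) k(2) large by simp
qed

section \<open>The extremal example and the value of \<open>g\<close>\<close>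

text \<open>This is the Gram matrix of the standard basis of \<open>n + 1\<close> space projected
  along the all-ones vector. The type \<open>option\<close> supplies the extra index, and
  \<open>None\<close> gets the vertex on the diagonal of \<open>real ^ 'n\<close>.\<close>

lemma regular_simplex_exists:
  obtains q :: "'n::finite option \<Rightarrow> real ^ 'n"
  where "\<And>i j. q i \<bullet> q j = (if i = j then 1 else 0) - 1 / (real CARD('n) + 1)"
proof
  define n where "n = real CARD('n)"
  define h where "h = sqrt (n + 1)"
  have n: "n > 0" by (simp add: n_def)
  have h: "h > 0" "h * h = n + 1" using n by (auto simp: h_def)
  define one :: "real ^ 'n" where "one = (\<chi> i. 1)"
  have one: "one \<bullet> one = n" "one \<bullet> axis i 1 = 1" "axis i 1 \<bullet> one = 1" for i
    by (simp add: one_def n_def inner_vec_def, simp add: one_def inner_axis,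
        subst inner_commute, simp add: one_def inner_axis)
  have axis: "axis i 1 \<bullet> (axis j 1 :: real ^ 'n) = (if i = j then 1 else 0)" for i j
    by (simp add: inner_axis_axis)
  \<comment> \<open>The solution of \<open>(1 / h) (1 - e n) = - 1 / (n + 1)\<close>, the inner
    product required between \<open>None\<close> and the other vertices.\<close>
  define e where "e = (1 + 1 / h) / n"
  define q :: "'n option \<Rightarrow> real ^ 'n" where
    "q i = (case i of None \<Rightarrow> (1 / h) *\<^sub>R one | Some i \<Rightarrow> axis i 1 - e *\<^sub>R one)" for i
  have eq: "(1 / h) * (1 / h) * n = 1 - 1 / (n + 1)" "(1 / h) * (1 - e * n) = - 1 / (n + 1)"
    "e * e * n - 2 * e = - 1 / (n + 1)"
  proof -
    have n1: "n = h * h - 1" "n + 1 = h * h" using h by auto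
    show "(1 / h) * (1 / h) * n = 1 - 1 / (n + 1)"
      unfolding n1(2) using h(1) by (simp add: n1(1) field_simps)
    show "(1 / h) * (1 - e * n) = - 1 / (n + 1)"
      unfolding n1(2) using h(1) n by (simp add: e_def)
    have "e * n = 1 + 1 / h" using n by (simp add: e_def)
    then have "e * (e * n - 2) = (1 + 1 / h) / n * (1 / h - 1)"
      by (simp add: e_def)
    then have "e * e * n - 2 * e = (1 + 1 / h) / n * (1 / h - 1)"
      by (simp only: right_diff_distrib mult.assoc mult.commute[of e 2])
    also have "\<dots> = (1 - h * h) / (h * h) / n"
      using h(1) by (simp add: field_simps)
    also have "1 - h * h = - n" using h(2) by simp
    finally show "e * e * n - 2 * e = - 1 / (n + 1)" using n h(2) by simp
  qed
  show "q i \<bullet> q j = (if i = j then 1 else 0) - 1 / (real CARD('n) + 1)" for i j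
    unfolding n_def[symmetric] using eq
    by (cases i; cases j) (auto simp: q_def one axis algebra_simps)
qed

text \<open>Sums of two vertices point to the edge midpoints of the simplex; their inner products
  depend only on the number of shared vertices, 0 or 1 for distinct edges.\<close>

lemma two_distance_set_of_simplex_edges:
  assumes "CARD('n::finite) \<ge> 3"
  shows "\<exists>S :: (real ^ 'n) set. S \<subseteq> sphere 0 1 \<and> two_distance_set S \<and>
    2 * card S = CARD('n) * (CARD('n) + 1)"
proof -
  define c where "c = 1 / (real CARD('n) + 1)"
  obtain q :: "'n option \<Rightarrow> real ^ 'n" where
    q: "\<And>i j. q i \<bullet> q j = (if i = j then 1 else 0) - c"
    using regular_simplex_exists unfolding c_def by blast
  have "c \<le> 1 / 4" unfolding c_def using assms by (intro divide_left_mono) auto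
  \<comment> \<open>The length of a sum of two distinct vertices, positive because
    \<open>c \<le> 1 / 4\<close>.\<close>
  define R where "R = sqrt (2 - 4 * c)"
  have R: "R > 0" "R * R = 2 - 4 * c" using \<open>c \<le> 1 / 4\<close> by (auto simp: R_def)
  define w where "w A = (1 / R) *\<^sub>R (\<Sum>i\<in>A. q i)" for A
  define E where "E = {A :: 'n option set. card A = 2}"
  have w: "w A \<bullet> w B = (real (card (A \<inter> B)) - 4 * c) / (2 - 4 * c)" if "A \<in> E" "B \<in> E" for A B
  proof -
    have "(\<Sum>i\<in>A. q i) \<bullet> (\<Sum>j\<in>B. q j) = (\<Sum>i\<in>A. \<Sum>j\<in>B. q i \<bullet> q j)"
      by (subst inner_sum_left) (simp add: inner_sum_right)
    also have "\<dots> = (\<Sum>i\<in>A. \<Sum>j\<in>B. if i = j then 1 else 0) - real (card A) * real (card B) * c"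
      by (simp add: q sum_subtractf)
    also have "(\<Sum>i\<in>A. \<Sum>j\<in>B. if i = j then 1 else 0) = (\<Sum>i\<in>A. if i \<in> B then 1 else 0 :: real)"
      by (intro sum.cong refl) simp
    also have "\<dots> = real (card (A \<inter> B))"
      by (simp add: sum.If_cases Int_def)
    finally show ?thesis using that R by (simp add: w_def E_def flip: R(2))
  qed
  have norm_w: "norm (w A) = 1" if "A \<in> E" for A
    using that w[OF that that] \<open>c \<le> 1 / 4\<close> by (auto simp: norm_eq_1 E_def)
  have d2: "(dist (w A) (w B))\<^sup>2 = (4 - 2 * real (card (A \<inter> B))) / (2 - 4 * c)"
    if "A \<in> E" "B \<in> E" for A B
    using dist_sphere_power2[OF norm_w norm_w, OF that] w[OF that] \<open>c \<le> 1 / 4\<close> by (simp add: field_simps)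
  have inter: "card (A \<inter> B) < 2" if "A \<in> E" "B \<in> E" "A \<noteq> B" for A B
  proof -
    have "A \<inter> B \<subset> A \<or> A \<inter> B \<subset> B" using that by blast
    then show ?thesis using that psubset_card_mono[of A "A \<inter> B"] psubset_card_mono[of B "A \<inter> B"]
      by (auto simp: E_def)
  qed
  define d where "d k = sqrt ((4 - 2 * real k) / (2 - 4 * c))" for k :: nat
  have dist: "dist (w A) (w B) = d (card (A \<inter> B))" if "A \<in> E" "B \<in> E" for A B
    unfolding d_def d2[OF that, symmetric] by simp
  have dpos: "d 0 > 0" "d 1 > 0" "d 0 \<noteq> d 1" using \<open>c \<le> 1 / 4\<close> by (auto simp: d_def)
  have inj: "inj_on w E"
  proof (rule inj_onI, rule ccontr)
    fix A B assume AB: "A \<in> E" "B \<in> E" "w A = w B" "A \<noteq> B"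
    then have "d (card (A \<inter> B)) = 0" using dist[of A B] by simp
    moreover have "card (A \<inter> B) = 0 \<or> card (A \<inter> B) = 1" using inter[of A B] AB by linarith
    ultimately show False using dpos by auto
  qed
  have "card E = CARD('n option) choose 2"
    using n_subsets[of "UNIV :: 'n option set" 2] by (simp add: E_def)
  then have cardE: "2 * card E = CARD('n) * (CARD('n) + 1)"
    by (simp add: choose_two card_UNIV_option algebra_simps)
  have "distances (w ` E) = {d 0, d 1}"
  proof
    show "distances (w ` E) \<subseteq> {d 0, d 1}"
    proof
      fix t assume "t \<in> distances (w ` E)"
      then obtain A B where AB: "A \<in> E" "B \<in> E" "w A \<noteq> w B" "t = dist (w A) (w B)"
        by (auto simp: distances_def)
      then have "A \<noteq> B" by auto
      with AB inter have "card (A \<inter> B) < 2" by blast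
      then have "card (A \<inter> B) = 0 \<or> card (A \<inter> B) = 1" by linarith
      then show "t \<in> {d 0, d 1}" using AB dist[of A B] by auto
    qed
    have mem: "d (card (A \<inter> B)) \<in> distances (w ` E)" if "A \<in> E" "B \<in> E" "A \<noteq> B" for A B
    proof -
      have "w A \<noteq> w B" using that inj_onD[OF inj, of A B] by blast
      then show ?thesis
        unfolding dist[OF that(1,2), symmetric] distances_def using that(1,2) by blast
    qed
    \<comment> \<open>Together with \<open>None\<close> these give four vertices: enough for two
      disjoint edges and for two edges sharing a vertex, so both distances occur.\<close>
    obtain T :: "'n set" where T: "card T = 3"
      using obtain_subset_with_card_n[of 3 "UNIV :: 'n set"] assms by auto
    then obtain x y z :: 'n where xyz: "x \<noteq> y" "x \<noteq> z" "y \<noteq> z" by (auto simp: card_3_iff)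
    have *: "{None, Some x} \<in> E" "{Some y, Some z} \<in> E" "{None, Some y} \<in> E"
      using xyz by (auto simp: E_def)
    have "{None, Some x} \<noteq> {Some y, Some z}" by blast
    then have "d 0 \<in> distances (w ` E)"
      using mem[OF *(1,2)] xyz by simp
    moreover have "{None, Some x} \<inter> {None, Some y} = {None}" "{None, Some x} \<noteq> {None, Some y}"
      using xyz by auto
    then have "d (card {None :: 'n option}) \<in> distances (w ` E)"
      using mem[OF *(1,3)] by metis
    then have "d 1 \<in> distances (w ` E)" by simp
    ultimately show "{d 0, d 1} \<subseteq> distances (w ` E)" by simp
  qed
  then have "two_distance_set (w ` E)"
    using dpos(3) by (simp add: two_distance_set_def)
  moreover have "w ` E \<subseteq> sphere 0 1" using norm_w by auto
  moreover have "card (w ` E) = card E" using inj by (rule card_image)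
  ultimately show ?thesis using cardE by (intro exI[of _ "w ` E"]) simp
qed

theorem theorem1:
  assumes "CARD('n::finite) \<ge> 7"
    and "\<not> (\<exists>k::nat. int CARD('n) = (2 * int k + 1)\<^sup>2 - 3)"
  shows "real (g TYPE('n)) = real CARD('n) * (real CARD('n) + 1) / 2"
proof -
  let ?C = "{card S | S :: (real ^ 'n) set. S \<subseteq> sphere 0 1 \<and> two_distance_set S}"
  let ?m = "CARD('n) * (CARD('n) + 1) div 2"
  have dim: "DIM(real ^ 'n) = CARD('n)" by simp
  have upper: "2 * card S \<le> CARD('n) * (CARD('n) + 1)"
    if "S \<subseteq> sphere 0 1" "two_distance_set S" for S :: "(real ^ 'n) set"
    using card_spherical_two_distance_set_le[OF that, unfolded dim, OF assms] .
  have le: "c \<le> ?m" if c: "c \<in> ?C" for c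
  proof -
    obtain S :: "(real ^ 'n) set" where "c = card S" "S \<subseteq> sphere 0 1" "two_distance_set S"
      using c by blast
    then show ?thesis using upper[of S] by linarith
  qed
  obtain S :: "(real ^ 'n) set" where S: "S \<subseteq> sphere 0 1" "two_distance_set S"
    "2 * card S = CARD('n) * (CARD('n) + 1)"
    using two_distance_set_of_simplex_edges[where 'n = 'n] assms(1) by auto
  \<comment> \<open>The division in \<open>?m\<close> is exact because
    \<open>n (n + 1) = 2 * card S\<close>.\<close>
  have "?m = card S" using S(3) by simp
  then have "?m \<in> ?C" using S(1,2) by blast
  \<comment> \<open>The uniform bound makes \<open>?C\<close> finite, which gives \<open>Max\<close>
    its meaning.\<close>
  moreover have "finite ?C" using le by (intro finite_subset[of ?C "{..?m}"]) auto
  ultimately have "g TYPE('n) = ?m" unfolding g_def using le by (intro Max_eqI)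
  with \<open>?m = card S\<close> have "2 * g TYPE('n) = CARD('n) * (CARD('n) + 1)" using S(3) by simp
  then have "real (2 * g TYPE('n)) = real (CARD('n) * (CARD('n) + 1))" by (simp only:)
  then show ?thesis by (simp add: algebra_simps)
qed

end
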